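(* Fix an integer $m\ge1$. Let $\mu,\nu\ge1$ be integers (depending on $n$) with $\mu+\nu=(1-\delta)n$, where $\delta=\delta(n)\in(0,1)$ is bounded away from $0$ and $1$. Let $\mathbb P(\mu,\nu)$ denote the probability that the event $\mathcal W$ holds and that there exists a pair $(A,B)$ of disjoint vertex sets in $G_m^n$ with $|A|=\mu$, $|B|=\nu$, such that no edge of $G_m^n$ joins $A$ and $B$. Then, for every $\varepsilon\in(0,1)$, $$\mathbb P(\mu,\nu)\le 2\binom{n}{\mu+\nu}\binom{\mu+\nu}{\mu}\exp\bigl(-mH_{\varepsilon,\delta}(\mu,\nu)\bigr),$$ $$H_{\varepsilon,\delta}(\mu,\nu):=\min\left\{\frac{2\varepsilon^2\sqrt\delta}{(1+\sqrt\delta)^2}\,\frac{\mu\nu}{\mu+\nu}\,;\ c(1-\varepsilon)g(\mu,\nu)\right\},$$ where $c=c(n)=\frac12-o(1)$ as $n\to\infty$, and, with $N=n+1$, $$h(\mu,\nu)=4\bigl(\sqrt{N-\nu}-\sqrt{N-\mu-\nu}\bigr)\bigl(\sqrt N-\sqrt{N-\nu}\bigr),$$ $$g(\mu,\nu)=\min\bigl(h(\mu,\nu),h(\nu,\mu)\bigr)=\begin{cases}h(\mu,\nu),&\mu\ge\nu,\\ h(\nu,\mu),&\mu\le\nu.\end{cases}$$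
   Context: Bollobás–Riordan preferential attachment multigraph $G_m^n$. Let $w_1,\dots,w_{mn+1}$ be independent exponential random variables with mean $1$, $W_k=\sum_{i=1}^k w_i$, $W_0=0$. Put $R_k=W_k/W_{mn+1}$ for $k=1,\dots,mn$, $R_0=0$. Conditionally on $\mathbf W=\{W_k\}$, let $\ell_1,\dots,\ell_{mn}$ be independent, $\ell_k$ having density $\frac{1}{2\sqrt{R_k x}}$ on $(0,R_k]$. The vertex set of $G_m^n$ is $[n]$; vertex $j$ is identified with the interval $(R_{m(j-1)},R_{mj}]$. For each $k\in[mn]$ there is one edge joining the vertex containing $R_k$ with the vertex containing $\ell_k$ (a loop if these coincide). The event $\mathcal W$ is $$\mathcal W=\bigcap_{\delta n\le j\le n}\left\{\frac{W_{mj}}{mj}\le 1+n^{-1/2}\log n\right\}.$$ *)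

theory Defs
  imports "HOL-Probability.Probability"
begin

definition W :: "(nat \<Rightarrow> real) \<Rightarrow> nat \<Rightarrow> real" where
  "W w k = (\<Sum>i = 1..k. w i)"

definition R :: "nat \<Rightarrow> nat \<Rightarrow> (nat \<Rightarrow> real) \<Rightarrow> nat \<Rightarrow> real" where
  "R m n w k = W w k / W w (m * n + 1)"

definition attach_density :: "real \<Rightarrow> real \<Rightarrow> real" where
  "attach_density r x = (if 0 < x \<and> x \<le> r then 1 / (2 * sqrt (r * x)) else 0)"

definition weight_law :: "nat \<Rightarrow> nat \<Rightarrow> (nat \<Rightarrow> real) measure" where
  "weight_law m n = PiM {1..m * n + 1} (\<lambda>_. density lborel (exponential_density 1))"

text \<open>The conditional law of the attachment points given the weights. It is a probability measure
  whenever all weights are positive, hence for almost all weights; elsewhere it is merely a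
  sub-probability measure.\<close>

definition attach_law :: "nat \<Rightarrow> nat \<Rightarrow> (nat \<Rightarrow> real) \<Rightarrow> (nat \<Rightarrow> real) measure" where
  "attach_law m n w = PiM {1..m * n} (\<lambda>k. density lborel (attach_density (R m n w k)))"

definition pa_space :: "nat \<Rightarrow> nat \<Rightarrow> ((nat \<Rightarrow> real) \<times> (nat \<Rightarrow> real)) measure" where
  "pa_space m n =
     do { w \<leftarrow> weight_law m n;
          l \<leftarrow> attach_law m n w;
          return (PiM {1..m * n + 1} (\<lambda>_. borel) \<Otimes>\<^sub>M PiM {1..m * n} (\<lambda>_. borel)) (w, l) }"

definition vertex_interval :: "nat \<Rightarrow> nat \<Rightarrow> (nat \<Rightarrow> real) \<Rightarrow> nat \<Rightarrow> real set" where
  "vertex_interval m n w j = {R m n w (m * (j - 1)) <.. R m n w (m * j)}"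

text \<open>The multigraph on the vertices \<open>{1..n}\<close> has one edge for every \<open>k \<in> {1..m * n}\<close>;
  \<open>edge_ends m n w l k\<close> is the set of its endpoints, a singleton if the edge is a loop.
  Different \<open>k\<close> with the same endpoints are parallel edges.\<close>

definition edge_ends :: "nat \<Rightarrow> nat \<Rightarrow> (nat \<Rightarrow> real) \<Rightarrow> (nat \<Rightarrow> real) \<Rightarrow> nat \<Rightarrow> nat set" where
  "edge_ends m n w l k =
     {j \<in> {1..n}. R m n w k \<in> vertex_interval m n w j \<or> l k \<in> vertex_interval m n w j}"

definition no_edge_between ::
  "nat \<Rightarrow> nat \<Rightarrow> (nat \<Rightarrow> real) \<Rightarrow> (nat \<Rightarrow> real) \<Rightarrow> nat set \<Rightarrow> nat set \<Rightarrow> bool" where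
  "no_edge_between m n w l A B \<longleftrightarrow>
     \<not> (\<exists>k \<in> {1..m * n}. \<exists>a \<in> A. \<exists>b \<in> B. edge_ends m n w l k = {a, b})"

definition W_event :: "nat \<Rightarrow> nat \<Rightarrow> real \<Rightarrow> (nat \<Rightarrow> real) \<Rightarrow> bool" where
  "W_event m n \<delta> w \<longleftrightarrow>
     (\<forall>j::nat. \<delta> * real n \<le> real j \<and> j \<le> n \<longrightarrow>
        W w (m * j) / real (m * j) \<le> 1 + real n powr (-1/2) * ln (real n))"

definition separation_prob :: "nat \<Rightarrow> nat \<Rightarrow> real \<Rightarrow> nat \<Rightarrow> nat \<Rightarrow> real" where
  "separation_prob m n \<delta> \<mu> \<nu> =
     measure (pa_space m n)
       {(w, l) \<in> space (pa_space m n).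
          W_event m n \<delta> w \<and>
          (\<exists>A B. A \<subseteq> {1..n} \<and> B \<subseteq> {1..n} \<and> A \<inter> B = {} \<and> card A = \<mu> \<and> card B = \<nu> \<and>
                 no_edge_between m n w l A B)}"

definition h :: "nat \<Rightarrow> nat \<Rightarrow> nat \<Rightarrow> real" where
  "h n \<mu> \<nu> = (let N = real n + 1 in
     4 * (sqrt (N - real \<nu>) - sqrt (N - real \<mu> - real \<nu>)) * (sqrt N - sqrt (N - real \<nu>)))"

definition g :: "nat \<Rightarrow> nat \<Rightarrow> nat \<Rightarrow> real" where
  "g n \<mu> \<nu> = min (h n \<mu> \<nu>) (h n \<nu> \<mu>)"

definition H :: "real \<Rightarrow> nat \<Rightarrow> real \<Rightarrow> real \<Rightarrow> nat \<Rightarrow> nat \<Rightarrow> real" where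
  "H c n \<epsilon> \<delta> \<mu> \<nu> =
     min (2 * \<epsilon>\<^sup>2 * sqrt \<delta> / (1 + sqrt \<delta>)\<^sup>2 * (real \<mu> * real \<nu> / (real \<mu> + real \<nu>)))
         (c * (1 - \<epsilon>) * g n \<mu> \<nu>)"


text \<open>The sampling procedure above is well formed: the kernel is measurable, the total mass is one,
  and the event in \<open>separation_prob\<close> is measurable.\<close>

lemma measurable_attach_density [measurable]:
  "(\<lambda>(r, x). attach_density r x) \<in> borel_measurable (borel \<Otimes>\<^sub>M borel)"
  unfolding attach_density_def by measurable

lemma nn_integral_attach_density:
  assumes "0 < r"
  shows "(\<integral>\<^sup>+x. ennreal (attach_density r x) \<partial>lborel) = 1"
proof -
  have "((\<lambda>x. 1 / (2 * sqrt (r * x))) has_integral (sqrt r / sqrt r - sqrt 0 / sqrt r)) {0..r}"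
  proof (rule fundamental_theorem_of_calculus_interior)
    show "continuous_on {0..r} (\<lambda>x. sqrt x / sqrt r)"
      using assms by (intro continuous_intros) auto
    fix x assume "x \<in> {0<..<r}"
    then have "((\<lambda>x. sqrt x / sqrt r) has_real_derivative 1 / (2 * sqrt (r * x))) (at x)"
      using assms by (auto intro!: derivative_eq_intros simp: real_sqrt_mult field_simps)
    then show "((\<lambda>x. sqrt x / sqrt r) has_vector_derivative 1 / (2 * sqrt (r * x))) (at x)"
      by (simp add: has_real_derivative_iff_has_vector_derivative)
  qed (use assms in auto)
  then have "((\<lambda>x. 1 / (2 * sqrt (r * x))) has_integral 1) {0..r}"
    using assms by simp
  moreover have "negligible {0::real}" by simp
  ultimately have "(attach_density r has_integral 1) {0..r}"
    by (rule has_integral_spike[rotated 2, of _ 1]) (auto simp: attach_density_def)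
  then have "((\<lambda>x. if x \<in> {0..r} then attach_density r x else 0) has_integral 1) UNIV"
    by (subst has_integral_restrict_UNIV)
  also have "(\<lambda>x. if x \<in> {0..r} then attach_density r x else 0) = attach_density r"
    by (auto simp: attach_density_def)
  finally have "(attach_density r has_integral 1) UNIV" .
  moreover have "0 \<le> attach_density r x" for x
    by (auto simp: attach_density_def)
  ultimately show ?thesis
    by (subst nn_integral_has_integral_lborel[where I = 1]) simp_all
qed

lemma prob_space_attach_density:
  "0 < r \<Longrightarrow> prob_space (density lborel (attach_density r))"
  by (intro prob_spaceI) (simp add: emeasure_density nn_integral_attach_density)

lemma emeasure_attach_density_le:
  "emeasure (density lborel (attach_density r)) UNIV \<le> 1"
proof (cases "0 < r")
  case True
  then show ?thesis by (simp add: emeasure_density nn_integral_attach_density)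
next
  case False
  then have "attach_density r = (\<lambda>_. 0)" by (auto simp: attach_density_def)
  then show ?thesis by (simp add: emeasure_density)
qed

lemma finite_measure_attach_density:
  "finite_measure (density lborel (attach_density r))"
  using emeasure_attach_density_le[of r]
  by (intro finite_measureI) (auto simp: top_unique)

lemma product_sigma_finite_attach:
  "product_sigma_finite (\<lambda>k::nat. density lborel (attach_density (f k)))"
  unfolding product_sigma_finite_def
  using finite_measure_attach_density by (blast intro: finite_measure.axioms)

lemma emeasure_attach_law:
  assumes "\<And>k. k \<in> {1..m * n} \<Longrightarrow> A k \<in> sets borel"
  shows "emeasure (attach_law m n w) (Pi\<^sub>E {1..m * n} A) =
    (\<Prod>k = 1..m * n. \<integral>\<^sup>+x. ennreal (attach_density (R m n w k) x) * indicator (A k) x \<partial>lborel)"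
  unfolding attach_law_def
  by (subst product_sigma_finite.emeasure_PiM[OF product_sigma_finite_attach])
     (auto simp: assms emeasure_density intro!: prod.cong)

lemma sets_attach_law [measurable_cong]:
  "sets (attach_law m n w) = sets (PiM {1..m * n} (\<lambda>_. borel))"
  unfolding attach_law_def by (intro sets_PiM_cong) auto

lemma space_attach_law: "space (attach_law m n w) = Pi\<^sub>E {1..m * n} (\<lambda>_. UNIV)"
  unfolding attach_law_def by (simp add: space_PiM)

lemma sets_weight_law [measurable_cong]:
  "sets (weight_law m n) = sets (PiM {1..m * n + 1} (\<lambda>_. borel))"
  unfolding weight_law_def by (intro sets_PiM_cong) auto

lemma measurable_W [measurable]:
  "k \<le> m * n + 1 \<Longrightarrow> (\<lambda>w. W w k) \<in> borel_measurable (PiM {1..m * n + 1} (\<lambda>_. borel))"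
  unfolding W_def by (intro borel_measurable_sum measurable_component_singleton) auto

lemma measurable_R [measurable]:
  "k \<le> m * n + 1 \<Longrightarrow> (\<lambda>w. R m n w k) \<in> borel_measurable (PiM {1..m * n + 1} (\<lambda>_. borel))"
  unfolding R_def by (intro borel_measurable_divide measurable_W) auto

lemma measurable_attach_law [measurable]:
  "attach_law m n \<in> weight_law m n \<rightarrow>\<^sub>M subprob_algebra (PiM {1..m * n} (\<lambda>_. borel))"
proof (rule measurable_subprob_algebra_generated[OF sets_PiM Int_stable_prod_algebra])
  show "prod_algebra {1..m * n} (\<lambda>_. borel) \<subseteq> Pow (Pi\<^sub>E {1..m * n} (\<lambda>_. space borel))"
    by (rule prod_algebra_sets_into_space)
  have box: "(\<lambda>w. emeasure (attach_law m n w) (Pi\<^sub>E {1..m * n} A)) \<in> borel_measurable (weight_law m n)"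
    if A: "\<And>k. k \<in> {1..m * n} \<Longrightarrow> A k \<in> sets borel" for A :: "nat \<Rightarrow> real set"
  proof -
    have "(\<lambda>w. \<integral>\<^sup>+x. ennreal (attach_density (R m n w k) x) * indicator (A k) x \<partial>lborel)
        \<in> borel_measurable (weight_law m n)" if k: "k \<in> {1..m * n}" for k
    proof -
      note A[OF k, measurable]
      have [measurable]: "(\<lambda>w. R m n w k) \<in> borel_measurable (weight_law m n)"
        using measurable_R[of k m n] k by (simp cong: measurable_cong_sets add: sets_weight_law)
      show ?thesis by measurable
    qed
    then show ?thesis
      by (subst emeasure_attach_law[OF A]) (auto intro!: borel_measurable_prod_ennreal)
  qed
  show "(\<lambda>w. emeasure (attach_law m n w) (Pi\<^sub>E {1..m * n} (\<lambda>_. space borel)))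
      \<in> borel_measurable (weight_law m n)"
    by (rule box) auto
  fix X assume "X \<in> prod_algebra {1..m * n} (\<lambda>_. borel :: real measure)"
  then obtain A where "X = Pi\<^sub>E {1..m * n} A" "A \<in> (\<Pi> k\<in>{1..m * n}. sets borel)"
    by (auto simp: prod_algebra_eq_finite)
  then show "(\<lambda>w. emeasure (attach_law m n w) X) \<in> borel_measurable (weight_law m n)"
    using box[of A] by (simp add: Pi_iff)
next
  fix w
  show "sets (attach_law m n w) = sets (PiM {1..m * n} (\<lambda>_. borel))"
    by (rule sets_attach_law)
  have "emeasure (attach_law m n w) (space (attach_law m n w)) =
      (\<Prod>k = 1..m * n. emeasure (density lborel (attach_density (R m n w k))) UNIV)"
    unfolding space_attach_law by (subst emeasure_attach_law) (auto simp: emeasure_density)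
  also have "\<dots> \<le> (\<Prod>k = 1..m * n. 1)"
    by (intro prod_mono_ennreal emeasure_attach_density_le)
  finally show "subprob_space (attach_law m n w)"
    by (intro subprob_spaceI) (auto simp: space_attach_law PiE_eq_empty_iff)
qed

lemma prob_space_weight_law: "prob_space (weight_law m n)"
  unfolding weight_law_def by (intro prob_space_PiM prob_space_exponential_density) auto

lemma AE_weight_law_pos: "AE w in weight_law m n. \<forall>i \<in> {1..m * n + 1}. 0 < w i"
proof -
  have "AE x in lborel. x \<noteq> (0::real)" by (rule AE_lborel_singleton)
  then have "AE x in density lborel (exponential_density 1). 0 < x"
    by (subst AE_density) (auto elim!: eventually_mono simp: exponential_density_def split: if_splits)
  then show ?thesis
    unfolding weight_law_def
    by (intro eventually_ball_finite ballI AE_PiM_component prob_space_exponential_density) auto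
qed

lemma R_pos:
  assumes "\<forall>i \<in> {1..m * n + 1}. 0 < w i" "k \<in> {1..m * n}"
  shows "0 < R m n w k"
  unfolding R_def W_def using assms by (intro divide_pos_pos sum_pos) auto

lemma prob_space_pa_space: "prob_space (pa_space m n)"
proof -
  interpret prob_space "weight_law m n" by (rule prob_space_weight_law)
  let ?K = "PiM {1..m * n + 1} (\<lambda>_. borel) \<Otimes>\<^sub>M PiM {1..m * n} (\<lambda>_. borel)"
  show ?thesis
    unfolding pa_space_def
  proof (rule prob_space_bind)
    show "AE w in weight_law m n. prob_space (attach_law m n w \<bind> (\<lambda>l. return ?K (w, l)))"
      using AE_weight_law_pos AE_space
    proof eventually_elim
      case (elim w)
      have w [measurable]: "w \<in> space (PiM {1..m * n + 1} (\<lambda>_. borel))"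
        using elim(2) sets_eq_imp_space_eq[OF sets_weight_law] by blast
      have "emeasure (attach_law m n w) (space (attach_law m n w)) =
          (\<Prod>k = 1..m * n. \<integral>\<^sup>+x. ennreal (attach_density (R m n w k) x) \<partial>lborel)"
        unfolding space_attach_law by (subst emeasure_attach_law) auto
      also have "\<dots> = 1"
        using R_pos[OF elim(1)] by (intro prod.neutral) (auto simp: nn_integral_attach_density)
      finally interpret A: prob_space "attach_law m n w" by (rule prob_spaceI)
      have "(\<lambda>l. (w, l)) \<in> attach_law m n w \<rightarrow>\<^sub>M ?K" by measurable
      then show ?case
        by (intro A.prob_space_bind[where S = ?K] AE_I2 prob_space_return)
           (auto dest: measurable_space)
    qed
    show "(\<lambda>w. attach_law m n w \<bind> (\<lambda>l. return ?K (w, l)))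
        \<in> weight_law m n \<rightarrow>\<^sub>M subprob_algebra ?K"
      by (rule measurable_bind[where N = "PiM {1..m * n} (\<lambda>_. borel)"]) measurable
  qed
qed

lemma sets_pa_space [measurable_cong]:
  "sets (pa_space m n) = sets (PiM {1..m * n + 1} (\<lambda>_. borel) \<Otimes>\<^sub>M PiM {1..m * n} (\<lambda>_. borel))"
  unfolding pa_space_def
proof (rule sets_bind)
  fix w assume "w \<in> space (weight_law m n)"
  show "sets (attach_law m n w \<bind>
      (\<lambda>l. return (PiM {1..m * n + 1} (\<lambda>_. borel) \<Otimes>\<^sub>M PiM {1..m * n} (\<lambda>_. borel)) (w, l))) =
    sets (PiM {1..m * n + 1} (\<lambda>_. borel) \<Otimes>\<^sub>M PiM {1..m * n} (\<lambda>_. borel))"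
    by (rule sets_bind) (auto simp: space_attach_law PiE_eq_empty_iff)
qed (rule prob_space.not_empty[OF prob_space_weight_law])

lemma separation_event_measurable:
  "{(w, l) \<in> space (pa_space m n).
      W_event m n \<delta> w \<and>
      (\<exists>A B. A \<subseteq> {1..n} \<and> B \<subseteq> {1..n} \<and> A \<inter> B = {} \<and> card A = \<mu> \<and> card B = \<nu> \<and>
             no_edge_between m n w l A B)} \<in> sets (pa_space m n)"
proof -
  let ?M = "pa_space m n"
  have W1: "(\<lambda>x. W (fst x) k) \<in> borel_measurable ?M" if "k \<le> m * n + 1" for k
    using measurable_compose[OF measurable_fst measurable_W[OF that]]
    by (simp cong: measurable_cong_sets add: sets_pa_space)
  have R1: "(\<lambda>x. R m n (fst x) k) \<in> borel_measurable ?M" if "k \<le> m * n + 1" for k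
    using measurable_compose[OF measurable_fst measurable_R[OF that]]
    by (simp cong: measurable_cong_sets add: sets_pa_space)
  have l1: "(\<lambda>x. snd x k) \<in> borel_measurable ?M" if "k \<in> {1..m * n}" for k
    using measurable_compose[OF measurable_snd measurable_component_singleton[OF that, of "\<lambda>_. borel"]]
    by (simp cong: measurable_cong_sets add: sets_pa_space)
  have le: "m * j \<le> m * n + 1" "m * (j - 1) \<le> m * n + 1" if "j \<le> n" for j
    using that by (auto intro!: le_SucI mult_le_mono)
  have WE: "W_event m n \<delta> w \<longleftrightarrow> (\<forall>j \<in> {j \<in> {..n}. \<delta> * real n \<le> real j}.
        W w (m * j) / real (m * j) \<le> 1 + real n powr (-1/2) * ln (real n))" for w
    unfolding W_event_def by auto
  have [measurable]: "Measurable.pred ?M (\<lambda>x. W_event m n \<delta> (fst x))"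
    unfolding WE
  proof (rule pred_intros_finite(3))
    fix j assume "j \<in> {j \<in> {..n}. \<delta> * real n \<le> real j}"
    then have [measurable]: "(\<lambda>x. W (fst x) (m * j)) \<in> borel_measurable ?M"
      by (intro W1 le) auto
    show "Measurable.pred ?M (\<lambda>x. W (fst x) (m * j) / real (m * j)
        \<le> 1 + real n powr (-1/2) * ln (real n))"
      by measurable
  qed auto
  have mem: "Measurable.pred ?M (\<lambda>x. j \<in> edge_ends m n (fst x) (snd x) k)"
    if "k \<in> {1..m * n}" for j k
  proof (cases "j \<in> {1..n}")
    case True
    then have [measurable]: "(\<lambda>x. R m n (fst x) (m * j)) \<in> borel_measurable ?M"
       "(\<lambda>x. R m n (fst x) (m * (j - 1))) \<in> borel_measurable ?M"
       "(\<lambda>x. R m n (fst x) k) \<in> borel_measurable ?M" "(\<lambda>x. snd x k) \<in> borel_measurable ?M"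
      using that by (auto intro!: R1 l1 le)
    show ?thesis
      unfolding edge_ends_def vertex_interval_def greaterThanAtMost_iff mem_Collect_eq by measurable
  next
    case False
    then have "(\<lambda>x. j \<in> edge_ends m n (fst x) (snd x) k) = (\<lambda>x. False)"
      unfolding edge_ends_def fun_eq_iff by blast
    then show ?thesis by (simp only: measurable_const space_count_space UNIV_I)
  qed
  have eq: "edge_ends m n w l k = {a, b} \<longleftrightarrow>
      a \<in> {1..n} \<and> b \<in> {1..n} \<and> (\<forall>j \<in> {1..n}. j \<in> edge_ends m n w l k \<longleftrightarrow> j = a \<or> j = b)"
    for w l k a b
  proof -
    have "edge_ends m n w l k \<subseteq> {1..n}" unfolding edge_ends_def by blast
    moreover have "S = {a, b} \<longleftrightarrow> a \<in> {1..n} \<and> b \<in> {1..n} \<and> (\<forall>j \<in> {1..n}. j \<in> S \<longleftrightarrow> j = a \<or> j = b)"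
      if "S \<subseteq> {1..n}" for S
      using that by blast
    ultimately show ?thesis by blast
  qed
  have NE: "Measurable.pred ?M (\<lambda>x. no_edge_between m n (fst x) (snd x) A B)"
    if "finite A" "finite B" for A B
    unfolding no_edge_between_def eq
    using that by (intro pred_intros_logic pred_intros_finite mem) auto
  let ?S = "{(A, B) \<in> Pow {1..n} \<times> Pow {1..n}. A \<inter> B = {} \<and> card A = \<mu> \<and> card B = \<nu>}"
  have fin: "finite ?S" by (rule finite_subset[of _ "Pow {1..n} \<times> Pow {1..n}"]) auto
  have "Measurable.pred ?M (\<lambda>x. \<exists>p \<in> ?S. no_edge_between m n (fst x) (snd x) (fst p) (snd p))"
  proof (rule pred_intros_finite(4)[OF fin])
    fix p assume "p \<in> ?S"
    then have "fst p \<subseteq> {1..n}" "snd p \<subseteq> {1..n}" by auto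
    then have "finite (fst p)" "finite (snd p)"
      using finite_subset finite_atLeastAtMost by blast+
    then show "Measurable.pred ?M (\<lambda>x. no_edge_between m n (fst x) (snd x) (fst p) (snd p))"
      by (rule NE)
  qed
  then have "Measurable.pred ?M (\<lambda>x. W_event m n \<delta> (fst x) \<and>
      (\<exists>p \<in> ?S. no_edge_between m n (fst x) (snd x) (fst p) (snd p)))"
    by measurable
  then have "{x \<in> space ?M. W_event m n \<delta> (fst x) \<and>
      (\<exists>p \<in> ?S. no_edge_between m n (fst x) (snd x) (fst p) (snd p))} \<in> sets ?M"
    by (simp add: pred_def)
  also have "{x \<in> space ?M. W_event m n \<delta> (fst x) \<and>
      (\<exists>p \<in> ?S. no_edge_between m n (fst x) (snd x) (fst p) (snd p))} =
     {(w, l) \<in> space (pa_space m n).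
      W_event m n \<delta> w \<and>
      (\<exists>A B. A \<subseteq> {1..n} \<and> B \<subseteq> {1..n} \<and> A \<inter> B = {} \<and> card A = \<mu> \<and> card B = \<nu> \<and>
             no_edge_between m n w l A B)}"
    by (simp add: set_eq_iff split_paired_all Bex_def conj_assoc)
  finally show ?thesis .
qed

end

theory Submission
  imports Defs
begin

text \<open>
  Fix disjoint sets \<open>A\<close>, \<open>B\<close>. Given the weights, the edges are independent, and edge \<open>k\<close> of
  vertex \<open>a\<close> hits the interval of an earlier vertex \<open>b\<close> of the opposite set with probability at least
  \<open>Y\<^sub>b / (2 * sqrt (W\<^sub>k * W\<^bsub>m b\<^esub>))\<close>, where \<open>Y\<^sub>b\<close> is the total weight of block \<open>b\<close>. Since
  \<open>d = \<delta> * n\<close> is an integer, the event on the weights gives \<open>W\<^bsub>m j\<^esub> \<le> m * max j d * (1 + o(1))\<close> for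
  every \<open>j\<close>, so the conditional probability of no edge is at most \<open>exp (- c * S)\<close> with
  \<open>c = 1/2 - o(1)\<close> and \<open>S\<close> a weighted sum of independent exponential variables of mean
  \<open>m * (\<Sum>a \<in> A. 1 / sqrt (max a d)) * (\<Sum>b \<in> B. 1 / sqrt (max b d))\<close>. A Chernoff bound for the lower
  tail of \<open>S\<close>, with the Kantorovich inequality controlling its variance, gives the first term of the
  minimum. If \<open>S\<close> is at least \<open>1 - \<epsilon>\<close> times its mean, the second term follows because the product of
  the two sums is smallest when \<open>A\<close> and \<open>B\<close> fill up the last vertices one after the other.
\<close>

section \<open>Blocks of indices and the coefficients of the weights\<close>

text \<open>For \<open>k >= 1\<close> this is \<open>k / m\<close> rounded up: the vertex whose
  interval contains \<open>R m n w k\<close> when all weights are positive.\<close>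

definition block :: "nat \<Rightarrow> nat \<Rightarrow> nat" where
  "block m k = (k - 1) div m + 1"

text \<open>The cut-off at \<open>d = \<delta> * n\<close> is there because the event on the weights says nothing about the
  vertices before \<open>d\<close>, whose partial sums are only bounded by that of \<open>d\<close>.\<close>

definition decay :: "nat \<Rightarrow> nat \<Rightarrow> real" where
  "decay d j = 1 / sqrt (real (max j d))"

text \<open>These are the vertices that an edge starting at \<open>a\<close> must avoid if it is not
  to join \<open>A\<close> and \<open>B\<close>. Only earlier vertices matter, since
  \<open>l k\<close> never exceeds \<open>R m n w k\<close>.\<close>

definition earlier_opposite :: "nat set \<Rightarrow> nat set \<Rightarrow> nat \<Rightarrow> nat set" where
  "earlier_opposite A B a = {b. b < a \<and> (a \<in> A \<and> b \<in> B \<or> a \<in> B \<and> b \<in> A)}"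

text \<open>Up to the factor \<open>1 / (2 * q)\<close> of \<open>attach_law_avoid_le\<close>, this
  is the coefficient of the total weight of block \<open>b\<close> in the exponent that bounds the
  conditional probability of no edge.\<close>

definition load :: "nat \<Rightarrow> nat \<Rightarrow> nat set \<Rightarrow> nat set \<Rightarrow> nat \<Rightarrow> real" where
  "load n d A B b = (\<Sum>a | a \<in> {1..n} \<and> b \<in> earlier_opposite A B a. decay d a * decay d b)"

lemma block_eq_iff:
  assumes "1 \<le> m" "1 \<le> k" "1 \<le> j"
  shows "block m k = j \<longleftrightarrow> m * (j - 1) < k \<and> k \<le> m * j"
proof -
  obtain i where i: "j = Suc i" using assms(3) by (cases j) auto
  obtain l where l: "k = Suc l" using assms(2) by (cases k) auto
  have "block m k = j \<longleftrightarrow> l div m = i" by (simp add: block_def i l)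
  also have "\<dots> \<longleftrightarrow> m * i \<le> l \<and> l < m * Suc i"
    using assms(1) dividend_less_times_div[of m l] times_div_less_eq_dividend[of m l]
    by (auto intro: div_nat_eqI)
  finally show ?thesis by (auto simp: i l)
qed

lemma block_range:
  assumes "k \<in> {1..m * n}"
  shows "block m k \<in> {1..n}"
proof -
  have "m \<noteq> 0" using assms by (cases m) auto
  moreover have "k - 1 < n * m" using assms by (auto simp: mult.commute)
  ultimately show ?thesis by (auto simp: block_def less_mult_imp_div_less Suc_le_eq)
qed

text \<open>Translates between the \<open>n\<close> interval lengths, which govern the attachment,
  and the \<open>m * n\<close> independent weights, to which the Laplace transform applies.\<close>

lemma sum_block_weighted:
  assumes "1 \<le> m"
  shows "(\<Sum>k = 1..m * n. f (block m k) * w k) = (\<Sum>j = 1..n. f j * (W w (m * j) - W w (m * (j - 1))))"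
proof (induction n)
  case (Suc n)
  have "(\<Sum>k = 1..m * Suc n. f (block m k) * w k) =
      (\<Sum>k = 1..m * n. f (block m k) * w k) + (\<Sum>k = m * n + 1..m * n + m. f (block m k) * w k)"
    using sum.ub_add_nat[of 1 "m * n" "\<lambda>k. f (block m k) * w k" m] by (simp add: add.commute)
  also have "(\<Sum>k = m * n + 1..m * n + m. f (block m k) * w k) =
      f (Suc n) * (\<Sum>k = m * n + 1..m * n + m. w k)"
    unfolding sum_distrib_left
  proof (intro sum.cong refl)
    fix k assume "k \<in> {m * n + 1..m * n + m}"
    then have "block m k = Suc n" using assms by (subst block_eq_iff) auto
    then show "f (block m k) * w k = f (Suc n) * w k" by simp
  qed
  also have "(\<Sum>k = m * n + 1..m * n + m. w k) = W w (m * Suc n) - W w (m * n)"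
    using sum.ub_add_nat[of 1 "m * n" w m] by (simp add: W_def add.commute)
  finally show ?case using Suc.IH by simp
qed simp

lemma sum_block:
  assumes "1 \<le> m"
  shows "(\<Sum>k = 1..m * n. f (block m k)) = real m * (\<Sum>j = 1..n. f j)"
proof -
  have "(\<Sum>k = 1..m * n. f (block m k)) = (\<Sum>j = 1..n. f j * real m)"
    using sum_block_weighted[OF assms, where f = f and w = "\<lambda>_. 1"]
    by (auto simp: W_def of_nat_diff diff_mult_distrib2 intro!: sum.cong)
  then show ?thesis by (simp add: sum_distrib_left mult.commute)
qed

subsection \<open>Geometry of the weights\<close>

lemma W_strict_mono:
  assumes "\<forall>i \<in> {1..m * n + 1}. 0 < w i" "i < j" "j \<le> m * n + 1"
  shows "W w i < W w j"
proof -
  have "W w j = W w i + (\<Sum>k = i + 1..j. w k)"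
    using sum.ub_add_nat[of 1 i w "j - i"] assms(2) by (simp add: W_def)
  moreover have "0 < (\<Sum>k = i + 1..j. w k)"
    using assms by (intro sum_pos) auto
  ultimately show ?thesis by simp
qed

lemma W_mono:
  assumes "\<forall>i \<in> {1..m * n + 1}. 0 < w i" "i \<le> j" "j \<le> m * n + 1"
  shows "W w i \<le> W w j"
  using W_strict_mono[OF assms(1), of i j] assms by (cases "i = j") auto

lemma W_pos:
  assumes "\<forall>i \<in> {1..m * n + 1}. 0 < w i" "1 \<le> j" "j \<le> m * n + 1"
  shows "0 < W w j"
  using W_strict_mono[OF assms(1), of 0 j] assms by (auto simp: W_def)

lemma W_nonneg:
  assumes "\<forall>i \<in> {1..m * n + 1}. 0 < w i" "j \<le> m * n + 1"
  shows "0 \<le> W w j"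
  using W_mono[OF assms(1), of 0 j] assms by (auto simp: W_def)

lemma R_less_iff:
  assumes "\<forall>i \<in> {1..m * n + 1}. 0 < w i" "i \<le> m * n" "j \<le> m * n"
  shows "R m n w i < R m n w j \<longleftrightarrow> i < j"
proof -
  have "W w i < W w j \<longleftrightarrow> i < j"
    using W_strict_mono[OF assms(1), of i j] W_mono[OF assms(1), of j i] assms
    by (meson le_SucI linorder_not_le Suc_eq_plus1 le_add1 le_trans)
  then show ?thesis
    using W_pos[OF assms(1), of "m * n + 1"] by (simp add: R_def divide_less_cancel)
qed

lemma R_mem_vertex_interval_iff:
  assumes "1 \<le> m" "\<forall>i \<in> {1..m * n + 1}. 0 < w i" "k \<in> {1..m * n}" "j \<in> {1..n}"
  shows "R m n w k \<in> vertex_interval m n w j \<longleftrightarrow> j = block m k"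
proof -
  have "m * j \<le> m * n" "m * (j - 1) \<le> m * n" using assms(4) by (auto intro!: mult_le_mono)
  then show ?thesis
    using assms R_less_iff[OF assms(2), of "m * (j - 1)" k] R_less_iff[OF assms(2), of "m * j" k]
      block_eq_iff[of m k j] unfolding vertex_interval_def by (auto simp: not_less)
qed

lemma disjoint_vertex_intervals:
  assumes "\<forall>i \<in> {1..m * n + 1}. 0 < w i" "i \<in> {1..n}" "j \<in> {1..n}" "i < j"
  shows "vertex_interval m n w i \<inter> vertex_interval m n w j = {}"
proof -
  have "m * i \<le> m * (j - 1)" "m * (j - 1) \<le> m * n" "m * i \<le> m * n"
    using assms by (auto intro!: mult_le_mono)
  then have "R m n w (m * i) \<le> R m n w (m * (j - 1))"
    using R_less_iff[OF assms(1), of "m * (j - 1)" "m * i"] by auto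
  then show ?thesis by (auto simp: vertex_interval_def)
qed

lemma vertex_interval_unique:
  assumes "\<forall>i \<in> {1..m * n + 1}. 0 < w i" "i \<in> {1..n}" "j \<in> {1..n}"
    "x \<in> vertex_interval m n w i" "x \<in> vertex_interval m n w j"
  shows "i = j"
  using disjoint_vertex_intervals[OF assms(1), of i j] disjoint_vertex_intervals[OF assms(1), of j i]
    assms(2-) by (metis disjoint_iff linorder_neqE_nat)

text \<open>If \<open>l k\<close> fell into such an interval, disjointness of the intervals would
  leave edge \<open>k\<close> exactly two ends, one in \<open>A\<close> and one in \<open>B\<close>.
  The graph event thus lies in a product event that constrains each \<open>l k\<close> separately,
  where conditional independence applies.\<close>

lemma no_edge_between_avoids:
  assumes "1 \<le> m" "\<forall>i \<in> {1..m * n + 1}. 0 < w i" "A \<subseteq> {1..n}" "B \<subseteq> {1..n}"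
    and "no_edge_between m n w l A B" "k \<in> {1..m * n}"
  shows "l k \<notin> (\<Union>b \<in> earlier_opposite A B (block m k). vertex_interval m n w b)"
proof
  assume "l k \<in> (\<Union>b \<in> earlier_opposite A B (block m k). vertex_interval m n w b)"
  then obtain b where b: "b \<in> earlier_opposite A B (block m k)" "l k \<in> vertex_interval m n w b"
    by blast
  have bn: "b \<in> {1..n}" using b assms(3,4) by (auto simp: earlier_opposite_def)
  have "R m n w k \<in> vertex_interval m n w j \<or> l k \<in> vertex_interval m n w j \<longleftrightarrow> j = block m k \<or> j = b"
    if j: "j \<in> {1..n}" for j
    using R_mem_vertex_interval_iff[OF assms(1,2,6) j] vertex_interval_unique[OF assms(2) j bn _ b(2)] b(2)
    by blast
  moreover have "edge_ends m n w l k = {j \<in> {1..n}. j = block m k \<or> j = b}"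
    unfolding edge_ends_def using calculation by blast
  ultimately have ends: "edge_ends m n w l k = {block m k, b}"
    using bn block_range[OF assms(6)] by blast
  \<comment> \<open>Either end may be the one in \<open>A\<close>, while
    \<open>no_edge_between\<close> fixes the order, so both forms are needed.\<close>
  then have ends': "edge_ends m n w l k = {b, block m k}" by (simp add: insert_commute)
  have "block m k \<in> A \<and> b \<in> B \<or> block m k \<in> B \<and> b \<in> A"
    using b(1) by (simp add: earlier_opposite_def)
  then show False
    using assms(5,6) ends ends' unfolding no_edge_between_def by blast
qed

subsection \<open>Conditional probability of avoiding the edges\<close>

text \<open>The density decreases on its support, so its value at the right end \<open>v\<close>
  bounds it from below on the whole interval.\<close>

lemma measure_attach_density_ge:
  assumes "0 < r" "0 \<le> u" "u \<le> v" "v \<le> r"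
  shows "(v - u) / (2 * sqrt (r * v)) \<le> measure (density lborel (attach_density r)) {u<..v}"
proof -
  let ?c = "1 / (2 * sqrt (r * v))"
  interpret prob_space "density lborel (attach_density r)"
    using assms(1) by (rule prob_space_attach_density)
  have "ennreal (?c * (v - u)) = (\<integral>\<^sup>+x. ennreal ?c * indicator {u<..v} x \<partial>lborel)"
    using assms by (simp add: nn_integral_cmult_indicator ennreal_mult' flip: ennreal_mult'')
  also have "\<dots> \<le> (\<integral>\<^sup>+x. ennreal (attach_density r x) * indicator {u<..v} x \<partial>lborel)"
  proof (intro nn_integral_mono)
    fix x
    have "?c \<le> attach_density r x" if "x \<in> {u<..v}"
    proof -
      have "sqrt (r * x) \<le> sqrt (r * v)" "0 < sqrt (r * x)"
        using that assms by auto
      then show ?thesis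
        using that assms by (auto simp: attach_density_def intro!: divide_left_mono)
    qed
    then show "ennreal ?c * indicator {u<..v} x \<le> ennreal (attach_density r x) * indicator {u<..v} x"
      by (auto simp: indicator_def intro!: ennreal_leI)
  qed
  also have "\<dots> = emeasure (density lborel (attach_density r)) {u<..v}"
    by (subst emeasure_density) auto
  finally show ?thesis
    by (simp add: emeasure_eq_measure)
qed

text \<open>The disjoint intervals of \<open>V\<close> lie to the left of \<open>R m n w k\<close>,
  so their probabilities add up and each is bounded by \<open>measure_attach_density_ge\<close>.
  Then \<open>1 - x <= exp (-x)\<close> gives the exponential form.\<close>

lemma attach_avoid_le:
  assumes "1 \<le> m" "\<forall>i \<in> {1..m * n + 1}. 0 < w i" "k \<in> {1..m * n}" "V \<subseteq> {1..<block m k}"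
  shows "(\<integral>\<^sup>+x. ennreal (attach_density (R m n w k) x) *
      indicator (- (\<Union>b \<in> V. vertex_interval m n w b)) x \<partial>lborel)
    \<le> ennreal (exp (- (\<Sum>b \<in> V. (W w (m * b) - W w (m * (b - 1))) / (2 * sqrt (W w k * W w (m * b))))))"
    (is "?L \<le> ennreal (exp (- ?E))")
proof -
  let ?M = "density lborel (attach_density (R m n w k))" and ?I = "vertex_interval m n w"
  have bk: "block m k \<in> {1..n}" by (rule block_range[OF assms(3)])
  interpret prob_space ?M
    by (rule prob_space_attach_density[OF R_pos[OF assms(2,3)]])
  have fin: "finite V" using assms(4) finite_subset by blast
  have Vn: "V \<subseteq> {1..n}" using assms(4) bk by auto
  have Im: "?I b \<in> sets borel" for b by (simp add: vertex_interval_def)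
  have T: "0 < W w (m * n + 1)" by (rule W_pos[OF assms(2)]) auto
  have "?E \<le> (\<Sum>b \<in> V. prob (?I b))"
  proof (rule sum_mono)
    fix b assume b: "b \<in> V"
    \<comment> \<open>The block of \<open>b\<close> ends before index \<open>k\<close>, so its
      interval lies inside the support of the density.\<close>
    have "b < block m k" using b assms(4) by auto
    then have "m * b \<le> m * (block m k - 1)" by (intro mult_le_mono) linarith+
    also have "\<dots> < k" using block_eq_iff[OF assms(1), of k "block m k"] assms(3) bk by auto
    finally have bk': "m * b \<le> k" by simp
    have bn: "1 \<le> b" "b \<le> n" using b Vn by auto
    have k': "1 \<le> k" "k \<le> m * n + 1" "m * b \<le> m * n + 1" "1 \<le> m * b" "m * (b - 1) \<le> m * n + 1"
      "m * (b - 1) \<le> m * b"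
      using assms(1,3) bn bk' by (auto intro!: le_SucI)
    have Wk: "0 < W w k" "0 < W w (m * b)" "0 \<le> W w (m * (b - 1))"
        "W w (m * (b - 1)) \<le> W w (m * b)" "W w (m * b) \<le> W w k"
      by (rule W_pos[OF assms(2) k'(1,2)] W_pos[OF assms(2) k'(4,3)] W_nonneg[OF assms(2) k'(5)]
          W_mono[OF assms(2) k'(6,3)] W_mono[OF assms(2) bk' k'(2)])+
    \<comment> \<open>Length and square root scale alike, so the normalisation by
      \<open>W w (m * n + 1)\<close> cancels and the exponent involves only the sums
      \<open>W\<close>.\<close>
    have "(W w (m * b) - W w (m * (b - 1))) / (2 * sqrt (W w k * W w (m * b))) =
        (R m n w (m * b) - R m n w (m * (b - 1))) / (2 * sqrt (R m n w k * R m n w (m * b)))"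
      using T Wk by (simp add: R_def real_sqrt_mult real_sqrt_divide field_simps)
    also have "\<dots> \<le> prob (?I b)"
      unfolding vertex_interval_def using T Wk
      by (intro measure_attach_density_ge) (auto simp: R_def divide_right_mono)
    finally show "(W w (m * b) - W w (m * (b - 1))) / (2 * sqrt (W w k * W w (m * b))) \<le> prob (?I b)" .
  qed
  also have "\<dots> = prob (\<Union>b \<in> V. ?I b)"
  proof (rule finite_measure_finite_Union[symmetric, OF fin])
    show "disjoint_family_on ?I V"
      unfolding disjoint_family_on_def using vertex_interval_unique[OF assms(2)] Vn by blast
  qed (use Im in auto)
  finally have E: "?E \<le> prob (\<Union>b \<in> V. ?I b)" .
  define U where "U = (\<Union>b \<in> V. ?I b)"
  have U: "U \<in> sets borel" unfolding U_def using fin Im by (intro sets.finite_UN)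
  have "?L = emeasure ?M (- U)"
    unfolding U_def[symmetric] using borel_comp[OF U] by (subst emeasure_density) auto
  also have "\<dots> = ennreal (1 - prob U)"
    using prob_compl[of U] U by (simp add: emeasure_eq_measure Compl_eq_Diff_UNIV)
  also have "\<dots> \<le> ennreal (exp (- ?E))"
    using E[folded U_def] exp_ge_add_one_self[of "- ?E"] by (intro ennreal_leI) linarith
  finally show ?thesis .
qed


text \<open>Since \<open>d\<close> equals \<open>\<delta> * n\<close> exactly, the event covers the
  index \<open>d\<close> itself; smaller \<open>j\<close> are compared with \<open>d\<close> by
  monotonicity of the partial sums.\<close>

lemma W_event_bound:
  assumes "1 \<le> m" "\<forall>i \<in> {1..m * n + 1}. 0 < w i" "W_event m n \<delta> w"
    and "real d = \<delta> * real n" "1 \<le> d" "d \<le> n" "j \<le> n"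
  shows "W w (m * j) \<le> real m * real (max j d) * (1 + real n powr (-1/2) * ln (real n))"
proof -
  let ?x = "max j d"
  have "W w (m * j) \<le> W w (m * ?x)"
    using assms by (intro W_mono[OF assms(2)]) (auto intro!: le_SucI)
  moreover have "\<delta> * real n \<le> real ?x \<and> ?x \<le> n"
    using assms(6,7) unfolding assms(4)[symmetric] by auto
  then have "W w (m * ?x) / real (m * ?x) \<le> 1 + real n powr (-1/2) * ln (real n)"
    using assms(3) unfolding W_event_def by blast
  then have "W w (m * ?x) \<le> (1 + real n powr (-1/2) * ln (real n)) * real (m * ?x)"
    using assms by (subst (asm) pos_divide_le_eq) auto
  ultimately show ?thesis by (simp add: mult_ac)
qed

text \<open>The box has product measure, so the exponents of \<open>attach_avoid_le\<close> add up.
  On the event their denominators are at most deterministic quantities, which leaves a linear form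
  in the weights; exchanging the order of summation collects its coefficients into
  \<open>load\<close>.\<close>

lemma attach_law_avoid_le:
  assumes "1 \<le> m" "\<forall>i \<in> {1..m * n + 1}. 0 < w i" "W_event m n \<delta> w"
    and "real d = \<delta> * real n" "1 \<le> d" "d \<le> n" "A \<subseteq> {1..n}" "B \<subseteq> {1..n}"
  defines "q \<equiv> 1 + real n powr (-1/2) * ln (real n)"
  shows "emeasure (attach_law m n w) (Pi\<^sub>E {1..m * n}
      (\<lambda>k. - (\<Union>b \<in> earlier_opposite A B (block m k). vertex_interval m n w b)))
    \<le> ennreal (exp (- (\<Sum>k = 1..m * n. load n d A B (block m k) * w k) / (2 * q)))"
proof -
  let ?Y = "\<lambda>b. W w (m * b) - W w (m * (b - 1))" and ?O = "earlier_opposite A B"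
  have q: "0 < q" using assms(5,6) by (auto simp: q_def intro!: add_pos_nonneg mult_nonneg_nonneg)
  have O: "?O a \<subseteq> {1..<a}" for a using assms(7,8) by (auto simp: earlier_opposite_def)
  have fin: "finite (?O a)" for a using O finite_subset by blast
  have "?Y b * decay d (block m k) * decay d b / (2 * real m * q) \<le> ?Y b / (2 * sqrt (W w k * W w (m * b)))"
    if k: "k \<in> {1..m * n}" and b: "b \<in> ?O (block m k)" for k b
  proof -
    let ?a = "block m k"
    have a: "?a \<in> {1..n}" by (rule block_range[OF k])
    have bn: "1 \<le> b" "b \<le> n" using b O a by fastforce+
    have ka: "k \<le> m * ?a" using block_eq_iff[OF assms(1), of k ?a] k a by auto
    have le: "m * b \<le> m * n" "m * ?a \<le> m * n" using bn a by auto
    have "W w (m * (b - 1)) \<le> W w (m * b)"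
      using le(1) by (intro W_mono[OF assms(2)] mult_le_mono) linarith+
    then have Wp: "0 < W w k" "0 < W w (m * b)" "0 \<le> ?Y b"
      using assms(1) k bn by (auto intro!: W_pos[OF assms(2)] le_SucI simp: Suc_le_eq)
    \<comment> \<open>Moving from \<open>k\<close> to the end of its block makes the bound depend on
      \<open>k\<close> only through the vertex.\<close>
    have "W w k \<le> W w (m * ?a)" using ka le by (intro W_mono[OF assms(2)]) linarith+
    also have "\<dots> \<le> real m * real (max ?a d) * q"
      unfolding q_def using a by (intro W_event_bound[OF assms(1-6)]) auto
    finally have 1: "W w k \<le> real m * real (max ?a d) * q" .
    have 2: "W w (m * b) \<le> real m * real (max b d) * q"
      unfolding q_def using bn by (intro W_event_bound[OF assms(1-6)]) auto
    have "W w k * W w (m * b) \<le> (real m * real (max ?a d) * q) * (real m * real (max b d) * q)"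
      using Wp q by (intro mult_mono 1 2) auto
    also have "\<dots> = (real m * q)\<^sup>2 * (real (max ?a d) * real (max b d))"
      by (simp add: power2_eq_square mult_ac)
    finally have "sqrt (W w k * W w (m * b)) \<le> sqrt ((real m * q)\<^sup>2 * (real (max ?a d) * real (max b d)))"
      by (rule real_sqrt_le_mono)
    also have "\<dots> = real m * q * (sqrt (real (max ?a d)) * sqrt (real (max b d)))"
      using q by (simp add: real_sqrt_mult)
    finally have "?Y b / (2 * (real m * q * (sqrt (real (max ?a d)) * sqrt (real (max b d)))))
        \<le> ?Y b / (2 * sqrt (W w k * W w (m * b)))"
      using Wp q a bn assms(1) by (intro divide_left_mono) (auto intro!: mult_pos_pos)
    then show ?thesis
      by (simp add: decay_def mult_ac)
  qed
  then have "(\<Sum>k = 1..m * n. \<Sum>b \<in> ?O (block m k). ?Y b * decay d (block m k) * decay d b / (2 * real m * q))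
      \<le> (\<Sum>k = 1..m * n. \<Sum>b \<in> ?O (block m k). ?Y b / (2 * sqrt (W w k * W w (m * b))))"
    by (intro sum_mono) auto
  \<comment> \<open>All \<open>m\<close> indices of a vertex contribute the same term; this factor
    \<open>m\<close> then cancels the \<open>1 / m\<close> that came from bounding the partial
    sums.\<close>
  also have "(\<Sum>k = 1..m * n. \<Sum>b \<in> ?O (block m k). ?Y b * decay d (block m k) * decay d b / (2 * real m * q))
      = real m * (\<Sum>a = 1..n. \<Sum>b \<in> ?O a. ?Y b * decay d a * decay d b / (2 * real m * q))"
    by (rule sum_block[OF assms(1)])
  also have "\<dots> = (\<Sum>a = 1..n. \<Sum>b \<in> ?O a. ?Y b * decay d a * decay d b / (2 * q))"
    using assms(1) by (simp add: sum_distrib_left mult.assoc)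
  also have "\<dots> = (\<Sum>a = 1..n. \<Sum>b | b \<in> {1..n} \<and> b \<in> ?O a. ?Y b * decay d a * decay d b / (2 * q))"
  proof (intro sum.cong refl)
    fix a assume "a \<in> {1..n}"
    then show "?O a = {b. b \<in> {1..n} \<and> b \<in> ?O a}" using O[of a] by force
  qed
  also have "\<dots> = (\<Sum>b = 1..n. \<Sum>a | a \<in> {1..n} \<and> b \<in> ?O a. ?Y b * decay d a * decay d b / (2 * q))"
    by (rule sum.swap_restrict) auto
  also have "\<dots> = (\<Sum>b = 1..n. load n d A B b * ?Y b) / (2 * q)"
    by (simp add: load_def sum_divide_distrib sum_distrib_left mult_ac)
  also have "\<dots> = (\<Sum>k = 1..m * n. load n d A B (block m k) * w k) / (2 * q)"
    by (subst sum_block_weighted[OF assms(1)]) simp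
  finally have key: "(\<Sum>k = 1..m * n. load n d A B (block m k) * w k) / (2 * q)
      \<le> (\<Sum>k = 1..m * n. \<Sum>b \<in> ?O (block m k). ?Y b / (2 * sqrt (W w k * W w (m * b))))" .
  have "emeasure (attach_law m n w) (Pi\<^sub>E {1..m * n} (\<lambda>k. - (\<Union>b \<in> ?O (block m k). vertex_interval m n w b)))
      = (\<Prod>k = 1..m * n. \<integral>\<^sup>+x. ennreal (attach_density (R m n w k) x) *
          indicator (- (\<Union>b \<in> ?O (block m k). vertex_interval m n w b)) x \<partial>lborel)"
    using fin by (intro emeasure_attach_law borel_comp sets.finite_UN) (auto simp: vertex_interval_def)
  also have "\<dots> \<le> (\<Prod>k = 1..m * n. ennreal (exp (- (\<Sum>b \<in> ?O (block m k). ?Y b / (2 * sqrt (W w k * W w (m * b)))))))"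
    by (intro prod_mono_ennreal attach_avoid_le[OF assms(1,2)] O)
  also have "\<dots> = ennreal (exp (- (\<Sum>k = 1..m * n. \<Sum>b \<in> ?O (block m k). ?Y b / (2 * sqrt (W w k * W w (m * b))))))"
    by (simp add: prod_ennreal exp_sum sum_negf[symmetric])
  also have "\<dots> \<le> ennreal (exp (- (\<Sum>k = 1..m * n. load n d A B (block m k) * w k) / (2 * q)))"
    using key by (intro ennreal_leI) simp
  finally show ?thesis .
qed

subsection \<open>Lower tail of weighted sums of exponential variables\<close>

text \<open>After taking logarithms, the difference of the two sides vanishes at 0 and has
  derivative \<open>x^2 / (1 + x)\<close>. The bound makes the lower tail of an exponential variable
  sub-Gaussian.\<close>

lemma inverse_one_plus_le_exp:
  assumes "0 \<le> (s::real)"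
  shows "1 / (1 + s) \<le> exp (- s + s\<^sup>2 / 2)"
proof -
  let ?f = "\<lambda>s::real. ln (1 + s) - s + s\<^sup>2 / 2"
  have "?f 0 \<le> ?f s"
  proof (rule DERIV_nonneg_imp_nondecreasing[OF assms])
    fix x :: real assume x: "0 \<le> x" "x \<le> s"
    have "(?f has_real_derivative (1 / (1 + x) - 1 + x)) (at x)"
      using x by (auto intro!: derivative_eq_intros)
    moreover have "1 / (1 + x) - 1 + x = x\<^sup>2 / (1 + x)"
      using x by (simp add: field_simps power2_eq_square)
    ultimately show "\<exists>y. (?f has_real_derivative y) (at x) \<and> 0 \<le> y"
      using x by auto
  qed
  then have "exp (- ln (1 + s)) \<le> exp (- s + s\<^sup>2 / 2)" by simp
  then show ?thesis using assms by (simp add: exp_minus field_simps)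
qed

text \<open>Exponential tilting: the factor \<open>exp (- (s * x))\<close> turns the density of rate
  1 into \<open>1 / (1 + s)\<close> times the density of rate \<open>1 + s\<close>, whose mass is
  1.\<close>

lemma nn_integral_exponential_laplace:
  assumes "0 \<le> s"
  shows "(\<integral>\<^sup>+x. ennreal (exp (- (s * x))) \<partial>density lborel (exponential_density 1)) = ennreal (1 / (1 + s))"
proof -
  interpret prob_space "density lborel (exponential_density (1 + s))"
    using assms by (intro prob_space_exponential_density) auto
  have "(\<integral>\<^sup>+x. ennreal (exp (- (s * x))) \<partial>density lborel (exponential_density 1)) =
      (\<integral>\<^sup>+x. ennreal (exponential_density 1 x) * ennreal (exp (- (s * x))) \<partial>lborel)"
    by (subst nn_integral_density) auto
  also have "\<dots> = (\<integral>\<^sup>+x. ennreal (1 / (1 + s)) * ennreal (exponential_density (1 + s) x) \<partial>lborel)"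
  proof (intro nn_integral_cong)
    fix x :: real
    have "exponential_density 1 x * exp (- (s * x)) = 1 / (1 + s) * exponential_density (1 + s) x"
      using assms by (simp add: exponential_density_def exp_add[symmetric] algebra_simps del: exp_add)
        (simp add: field_simps)
    then show "ennreal (exponential_density 1 x) * ennreal (exp (- (s * x))) =
        ennreal (1 / (1 + s)) * ennreal (exponential_density (1 + s) x)"
      using assms by (simp add: exponential_density_nonneg flip: ennreal_mult)
  qed
  also have "\<dots> = ennreal (1 / (1 + s)) * (\<integral>\<^sup>+x. ennreal (exponential_density (1 + s) x) \<partial>lborel)"
    by (rule nn_integral_cmult) auto
  also have "(\<integral>\<^sup>+x. ennreal (exponential_density (1 + s) x) \<partial>lborel) = 1"
    using emeasure_space_1 by (simp add: emeasure_density)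
  finally show ?thesis by simp
qed

lemma weight_law_laplace_le:
  assumes "\<And>k. 0 \<le> T k"
  shows "(\<integral>\<^sup>+w. ennreal (exp (- (\<Sum>k = 1..m * n. T k * w k))) \<partial>weight_law m n)
    \<le> ennreal (exp (\<Sum>k = 1..m * n. - T k + (T k)\<^sup>2 / 2))"
proof -
  let ?E = "density lborel (exponential_density 1)"
  \<comment> \<open>The last weight, of index \<open>m * n + 1\<close>, is absent from the sum; with
    coefficient 0 it contributes a factor 1 to the product over all coordinates.\<close>
  let ?T = "\<lambda>k. if k \<le> m * n then T k else 0"
  have ps: "prob_space ?E" by (intro prob_space_exponential_density) auto
  interpret product_sigma_finite "\<lambda>_::nat. ?E"
    by (simp add: product_sigma_finite_def prob_space_imp_sigma_finite ps)
  have "(\<integral>\<^sup>+w. ennreal (exp (- (\<Sum>k = 1..m * n. T k * w k))) \<partial>weight_law m n) =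
      (\<integral>\<^sup>+w. (\<Prod>k = 1..m * n + 1. ennreal (exp (- (?T k * w k)))) \<partial>weight_law m n)"
    by (intro nn_integral_cong) (simp add: prod_ennreal exp_sum sum_negf[symmetric])
  also have "\<dots> = (\<Prod>k = 1..m * n + 1. \<integral>\<^sup>+x. ennreal (exp (- (?T k * x))) \<partial>?E)"
    unfolding weight_law_def by (rule product_nn_integral_prod) auto
  also have "\<dots> = (\<Prod>k = 1..m * n + 1. ennreal (1 / (1 + ?T k)))"
    using assms by (intro prod.cong refl nn_integral_exponential_laplace) auto
  also have "\<dots> \<le> (\<Prod>k = 1..m * n + 1. ennreal (exp (- ?T k + (?T k)\<^sup>2 / 2)))"
    using assms by (intro prod_mono_ennreal ennreal_leI inverse_one_plus_le_exp) auto
  also have "\<dots> = ennreal (exp (\<Sum>k = 1..m * n. - T k + (T k)\<^sup>2 / 2))"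
    by (simp add: prod_ennreal exp_sum)
  finally show ?thesis .
qed

subsection \<open>Inequalities for the decay weights\<close>

text \<open>Summing \<open>(z j - lo) * (hi - z j) >= 0\<close> bounds the sum of squares plus
  \<open>card A * lo * hi\<close> by \<open>(lo + hi)\<close> times the sum;
  \<open>4 * x * y <= (x + y)^2\<close> then yields the product form.\<close>

lemma kantorovich_sum:
  fixes z :: "'a \<Rightarrow> real"
  assumes "finite A" "0 \<le> lo" "\<And>j. j \<in> A \<Longrightarrow> lo \<le> z j \<and> z j \<le> hi"
  shows "4 * lo * hi * real (card A) * (\<Sum>j \<in> A. (z j)\<^sup>2) \<le> (lo + hi)\<^sup>2 * (\<Sum>j \<in> A. z j)\<^sup>2"
proof (cases "A = {}")
  case False
  then have hi: "0 \<le> hi" using assms(2,3) by (meson all_not_in_conv order_trans)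
  have "(z j)\<^sup>2 + lo * hi \<le> (lo + hi) * z j" if "j \<in> A" for j
  proof -
    have "0 \<le> (z j - lo) * (hi - z j)" using assms(3)[OF that] by (intro mult_nonneg_nonneg) auto
    then show ?thesis by (simp add: algebra_simps power2_eq_square)
  qed
  then have "(\<Sum>j \<in> A. (z j)\<^sup>2 + lo * hi) \<le> (\<Sum>j \<in> A. (lo + hi) * z j)" by (rule sum_mono)
  then have 1: "(\<Sum>j \<in> A. (z j)\<^sup>2) + real (card A) * (lo * hi) \<le> (lo + hi) * (\<Sum>j \<in> A. z j)"
    by (simp add: sum.distrib sum_distrib_left)
  have "4 * ((\<Sum>j \<in> A. (z j)\<^sup>2) * (real (card A) * (lo * hi)))
      \<le> ((\<Sum>j \<in> A. (z j)\<^sup>2) + real (card A) * (lo * hi))\<^sup>2"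
    using zero_le_power2[of "(\<Sum>j \<in> A. (z j)\<^sup>2) - real (card A) * (lo * hi)"]
    by (simp add: power2_eq_square algebra_simps)
  also have "\<dots> \<le> ((lo + hi) * (\<Sum>j \<in> A. z j))\<^sup>2"
    using 1 assms(2) hi by (intro power_mono) (auto intro!: add_nonneg_nonneg sum_nonneg)
  finally show ?thesis by (simp add: power_mult_distrib mult_ac)
qed simp

lemma decay_antimono: "1 \<le> d \<Longrightarrow> i \<le> j \<Longrightarrow> decay d j \<le> decay d i"
  by (auto simp: decay_def intro!: divide_left_mono)

lemma decay_pos: "1 \<le> d \<Longrightarrow> 0 < decay d j"
  by (auto simp: decay_def)

text \<open>An exchange argument: \<open>U\<close> and the final segment have equally many elements
  outside each other. Those of the segment lie beyond \<open>n - card U\<close> and those of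
  \<open>U\<close> do not, so the value there separates the two sums.\<close>

lemma sum_antimono_le_sum_subset:
  fixes z :: "nat \<Rightarrow> real"
  assumes "\<And>i j. i \<le> j \<Longrightarrow> z j \<le> z i" "U \<subseteq> {1..n}"
  shows "(\<Sum>j \<in> {n - card U<..n}. z j) \<le> (\<Sum>j \<in> U. z j)"
proof -
  let ?p = "n - card U" and ?V = "{n - card U<..n}"
  have fin: "finite U" using assms(2) finite_subset by blast
  have cU: "card U \<le> n" using card_mono[OF _ assms(2)] by simp
  have "card (?V - U) = card (U - ?V)"
    using card_Diff_subset_Int[of ?V U] card_Diff_subset_Int[of U ?V] fin cU by (simp add: Int_commute)
  moreover have "(\<Sum>j \<in> ?V - U. z j) \<le> real (card (?V - U)) * z ?p"
    using assms(1) by (intro sum_bounded_above) auto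
  moreover have "real (card (U - ?V)) * z ?p \<le> (\<Sum>j \<in> U - ?V. z j)"
    using assms by (intro sum_bounded_below) (auto simp: subset_iff not_less)
  ultimately have "(\<Sum>j \<in> ?V - U. z j) \<le> (\<Sum>j \<in> U - ?V. z j)" by simp
  then show ?thesis
    using sum.Int_Diff[of ?V z U] sum.Int_Diff[of U z ?V] fin by (simp add: Int_commute)
qed

text \<open>Comparison with the integral of \<open>1 / sqrt x\<close> from \<open>p + 1\<close> to
  \<open>n + 1\<close>, proved by telescoping. This shift by one is the origin of
  \<open>N = n + 1\<close> in \<open>h\<close>.\<close>

lemma sum_inverse_sqrt_ge:
  assumes "p \<le> n"
  shows "2 * (sqrt (real n + 1) - sqrt (real p + 1)) \<le> (\<Sum>j \<in> {p<..n}. 1 / sqrt (real j))"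
  using assms
proof (induction n rule: dec_induct)
  case (step n)
  have "{p<..Suc n} = insert (Suc n) {p<..n}" using step by auto
  moreover have "2 * (sqrt (real n + 2) - sqrt (real n + 1)) \<le> 1 / sqrt (real n + 1)"
  proof -
    have "0 \<le> (sqrt (real n + 2) - sqrt (real n + 1))\<^sup>2" by simp
    then have "2 * sqrt (real n + 2) * sqrt (real n + 1) \<le> (real n + 2) + (real n + 1)"
      by (simp add: power2_diff)
    then have "2 * (sqrt (real n + 2) - sqrt (real n + 1)) * sqrt (real n + 1) \<le> 1"
      by (simp add: algebra_simps)
    then show ?thesis by (simp add: pos_le_divide_eq)
  qed
  ultimately show ?case using step.IH by (simp add: add.commute)
qed simp

lemma sum_decay_ge:
  assumes "1 \<le> d" "U \<subseteq> {1..n}" "d + card U \<le> n"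
  shows "2 * (sqrt (real n + 1) - sqrt (real n + 1 - real (card U))) \<le> (\<Sum>j \<in> U. decay d j)"
proof -
  have "2 * (sqrt (real n + 1) - sqrt (real (n - card U) + 1)) \<le> (\<Sum>j \<in> {n - card U<..n}. 1 / sqrt (real j))"
    by (rule sum_inverse_sqrt_ge) simp
  \<comment> \<open>By \<open>d + card U <= n\<close> the final segment lies beyond
    \<open>d\<close>, where the cut-off in \<open>decay\<close> is inactive.\<close>
  also have "\<dots> = (\<Sum>j \<in> {n - card U<..n}. decay d j)"
    using assms(3) by (intro sum.cong) (auto simp: decay_def max_def)
  also have "\<dots> \<le> (\<Sum>j \<in> U. decay d j)"
    using decay_antimono[OF assms(1)] assms(2) by (rule sum_antimono_le_sum_subset)
  finally show ?thesis using assms(3) by (simp add: of_nat_diff algebra_simps)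
qed

text \<open>Concavity of the square root. After squaring, the radicands have equal sums on both
  sides, and their products differ by \<open>a * b >= 0\<close>.\<close>

lemma sqrt_superadditive_gap:
  fixes N a b :: real
  assumes "0 \<le> a" "0 \<le> b" "a + b \<le> N"
  shows "sqrt N + sqrt (N - a - b) \<le> sqrt (N - a) + sqrt (N - b)"
proof (rule power2_le_imp_le)
  have "N * (N - a - b) \<le> (N - a) * (N - b)" using assms by (simp add: algebra_simps)
  then have "sqrt (N * (N - a - b)) \<le> sqrt ((N - a) * (N - b))" by simp
  then show "(sqrt N + sqrt (N - a - b))\<^sup>2 \<le> (sqrt (N - a) + sqrt (N - b))\<^sup>2"
    using assms by (simp add: power2_sum real_sqrt_mult)
qed (use assms in auto)

text \<open>In the notation of the proof the difference of the two values is
  \<open>4 * (x - y) * (x + y - p - q)\<close>, and both variable factors are nonnegative.\<close>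

lemma h_le_h_swap:
  assumes "\<nu> \<le> \<mu>" "\<mu> + \<nu> \<le> n"
  shows "h n \<mu> \<nu> \<le> h n \<nu> \<mu>"
proof -
  define q p x y where "q = sqrt (real n + 1)" and "p = sqrt (real n + 1 - real \<mu> - real \<nu>)"
    and "x = sqrt (real n + 1 - real \<nu>)" and "y = sqrt (real n + 1 - real \<mu>)"
  have "q + p \<le> x + y"
    using sqrt_superadditive_gap[of "real \<mu>" "real \<nu>" "real n + 1"] assms
    unfolding q_def p_def x_def y_def by simp
  moreover have "y \<le> x" using assms by (simp add: x_def y_def)
  ultimately have "0 \<le> (x - y) * (x + y - p - q)" by (intro mult_nonneg_nonneg) auto
  moreover have "h n \<mu> \<nu> = 4 * (x - p) * (q - x)" "h n \<nu> \<mu> = 4 * (y - p) * (q - y)"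
    by (simp_all add: h_def Let_def p_def q_def x_def y_def diff_right_commute)
  ultimately show ?thesis by (simp add: algebra_simps)
qed

text \<open>The function \<open>s * (\<tau> - s)\<close> is concave, so on \<open>{\<alpha>..\<tau> - \<beta>}\<close> it is smallest at an endpoint.\<close>

lemma min_le_mult_of_sum_ge:
  fixes s t \<alpha> \<beta> \<tau> :: real
  assumes "\<alpha> \<le> s" "\<beta> \<le> t" "\<tau> \<le> s + t" "0 \<le> \<alpha>" "0 \<le> \<beta>"
  shows "min ((\<tau> - \<beta>) * \<beta>) ((\<tau> - \<alpha>) * \<alpha>) \<le> s * t"
proof (cases "\<tau> - \<beta> \<le> s")
  case True
  then have "(\<tau> - \<beta>) * \<beta> \<le> s * \<beta>" using assms by (intro mult_right_mono) auto
  also have "\<dots> \<le> s * t" using assms by (intro mult_left_mono) auto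
  finally show ?thesis by simp
next
  case False
  have st: "s * (\<tau> - s) \<le> s * t" using assms by (intro mult_left_mono) auto
  show ?thesis
  proof (cases "\<alpha> + s \<le> \<tau>")
    case True
    then have "0 \<le> (s - \<alpha>) * (\<tau> - s - \<alpha>)" using assms by (intro mult_nonneg_nonneg) auto
    then have "(\<tau> - \<alpha>) * \<alpha> \<le> s * (\<tau> - s)" by (simp add: algebra_simps)
    then show ?thesis using st by simp
  next
    case False2: False
    \<comment> \<open>The two failed cases give
      \<open>\<tau> - \<alpha> < s < \<tau> - \<beta>\<close>, hence
      \<open>\<beta> < \<alpha> <= s\<close>, so both factors are nonnegative.\<close>
    have "0 \<le> (\<tau> - \<beta> - s) * (s - \<beta>)"
      using False False2 assms by (intro mult_nonneg_nonneg) (auto simp: algebra_simps)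
    then have "(\<tau> - \<beta>) * \<beta> \<le> s * (\<tau> - s)" by (simp add: algebra_simps)
    then show ?thesis using st by simp
  qed
qed

section \<open>Moments of the loads and their comparison with the target bounds\<close>

lemma load_eq_if:
  "load n d A B b = (\<Sum>a = 1..n. if b \<in> earlier_opposite A B a then decay d a * decay d b else 0)"
  unfolding load_def by (rule sum.inter_filter) simp

lemma load_nonneg: "0 \<le> load n d A B b"
  unfolding load_def by (intro sum_nonneg) (auto simp: decay_def)

text \<open>Each pair in \<open>A \<times> B\<close> is counted exactly once, at its smaller member;
  disjointness rules out ties.\<close>

lemma sum_load:
  assumes "A \<subseteq> {1..n}" "B \<subseteq> {1..n}" "A \<inter> B = {}"
  shows "(\<Sum>b = 1..n. load n d A B b) = (\<Sum>a \<in> A. decay d a) * (\<Sum>b \<in> B. decay d b)"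
proof -
  let ?z = "decay d"
  define f where "f a b = (if a \<in> A \<and> b \<in> B then ?z a * ?z b else 0)" for a b
  have "(\<Sum>b = 1..n. load n d A B b) =
      (\<Sum>b = 1..n. \<Sum>a = 1..n. (if b < a then f a b else 0) + (if b < a then f b a else 0))"
    unfolding load_eq_if
    by (intro sum.cong refl) (use assms(3) in \<open>auto simp: earlier_opposite_def f_def\<close>)
  also have "\<dots> = (\<Sum>b = 1..n. \<Sum>a = 1..n. if b < a then f a b else 0) +
      (\<Sum>b = 1..n. \<Sum>a = 1..n. if b < a then f b a else 0)"
    by (simp add: sum.distrib)
  also have "(\<Sum>b = 1..n. \<Sum>a = 1..n. if b < a then f b a else 0) =
      (\<Sum>b = 1..n. \<Sum>a = 1..n. if a < b then f a b else 0)"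
    by (rule sum.swap)
  also have "(\<Sum>b = 1..n. \<Sum>a = 1..n. if b < a then f a b else 0) + \<dots> =
      (\<Sum>b = 1..n. \<Sum>a = 1..n. f a b)"
    unfolding sum.distrib[symmetric]
    by (intro sum.cong refl) (use assms(3) in \<open>auto simp: f_def\<close>)
  also have "\<dots> = (\<Sum>b \<in> B. \<Sum>a \<in> A. ?z a * ?z b)"
    using assms(1,2) unfolding f_def
    by (intro sum.mono_neutral_cong_right) (auto intro!: sum.mono_neutral_cong_right sum.neutral)
  also have "\<dots> = (\<Sum>a \<in> A. ?z a) * (\<Sum>b \<in> B. ?z b)"
    by (subst sum.swap) (simp add: sum_product)
  finally show ?thesis .
qed

text \<open>Dropping the order constraint bounds the load of a vertex by its own decay times the
  decay sum of the whole opposite set. Vertices outside both sets carry no load.\<close>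

lemma sum_load_square_le:
  assumes "A \<subseteq> {1..n}" "B \<subseteq> {1..n}" "A \<inter> B = {}"
  shows "(\<Sum>b = 1..n. (load n d A B b)\<^sup>2) \<le>
    (\<Sum>a \<in> A. (decay d a)\<^sup>2) * (\<Sum>b \<in> B. decay d b)\<^sup>2 + (\<Sum>b \<in> B. (decay d b)\<^sup>2) * (\<Sum>a \<in> A. decay d a)\<^sup>2"
proof -
  let ?z = "decay d" and ?l = "load n d A B"
  have fin: "finite A" "finite B" using assms finite_subset by blast+
  have z0: "0 \<le> ?z j" for j by (simp add: decay_def)
  have bound: "?l b \<le> ?z b * (\<Sum>a \<in> Y. ?z a)"
    if "finite Y" "\<And>a. b \<in> earlier_opposite A B a \<Longrightarrow> a \<in> Y" for b Y
  proof -
    have "?l b \<le> (\<Sum>a \<in> Y. ?z a * ?z b)"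
      unfolding load_def using that z0 by (intro sum_mono2) auto
    then show ?thesis by (simp add: sum_distrib_left mult.commute)
  qed
  have zero: "?l b = 0" if "b \<notin> A \<union> B" for b
    unfolding load_def using that by (intro sum.neutral) (auto simp: earlier_opposite_def)
  have "(\<Sum>b = 1..n. (?l b)\<^sup>2) = (\<Sum>b \<in> A \<union> B. (?l b)\<^sup>2)"
    using assms zero by (intro sum.mono_neutral_right) auto
  also have "\<dots> = (\<Sum>b \<in> A. (?l b)\<^sup>2) + (\<Sum>b \<in> B. (?l b)\<^sup>2)"
    using fin assms(3) by (rule sum.union_disjoint)
  also have "\<dots> \<le> (\<Sum>b \<in> A. (?z b * (\<Sum>a \<in> B. ?z a))\<^sup>2) + (\<Sum>b \<in> B. (?z b * (\<Sum>a \<in> A. ?z a))\<^sup>2)"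
    using assms(3) fin
    by (intro add_mono sum_mono power_mono bound load_nonneg) (auto simp: earlier_opposite_def)
  finally show ?thesis by (simp add: power_mult_distrib sum_distrib_right)
qed

text \<open>\<open>\<alpha>\<close>, \<open>\<beta>\<close> and \<open>\<tau>\<close> are the lower
  bounds of \<open>sum_decay_ge\<close> for \<open>A\<close>, \<open>B\<close> and their union. The
  two endpoint values in \<open>min_le_mult_of_sum_ge\<close> are then exactly the two values of
  \<open>h\<close>.\<close>

lemma g_le_decay_sums:
  assumes "1 \<le> d" "A \<subseteq> {1..n}" "B \<subseteq> {1..n}" "A \<inter> B = {}" "d + card A + card B \<le> n"
  shows "g n (card A) (card B) \<le> (\<Sum>a \<in> A. decay d a) * (\<Sum>b \<in> B. decay d b)"
proof -
  define \<alpha> \<beta> \<tau> where "\<alpha> = 2 * (sqrt (real n + 1) - sqrt (real n + 1 - real (card A)))"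
    and "\<beta> = 2 * (sqrt (real n + 1) - sqrt (real n + 1 - real (card B)))"
    and "\<tau> = 2 * (sqrt (real n + 1) - sqrt (real n + 1 - real (card A) - real (card B)))"
  have fin: "finite A" "finite B" using assms finite_subset by blast+
  have "2 * (sqrt (real n + 1) - sqrt (real n + 1 - real (card (A \<union> B)))) \<le> (\<Sum>j \<in> A \<union> B. decay d j)"
    using assms fin by (intro sum_decay_ge) (auto simp: card_Un_disjoint)
  then have "\<tau> \<le> (\<Sum>a \<in> A. decay d a) + (\<Sum>b \<in> B. decay d b)"
    using fin assms(4) by (simp add: \<tau>_def card_Un_disjoint sum.union_disjoint algebra_simps)
  moreover have "\<alpha> \<le> (\<Sum>a \<in> A. decay d a)"
    unfolding \<alpha>_def using assms by (intro sum_decay_ge) auto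
  moreover have "\<beta> \<le> (\<Sum>b \<in> B. decay d b)"
    unfolding \<beta>_def using assms by (intro sum_decay_ge) auto
  ultimately have "min ((\<tau> - \<beta>) * \<beta>) ((\<tau> - \<alpha>) * \<alpha>) \<le> (\<Sum>a \<in> A. decay d a) * (\<Sum>b \<in> B. decay d b)"
    by (intro min_le_mult_of_sum_ge) (auto simp: \<alpha>_def \<beta>_def)
  moreover have "h n (card A) (card B) = (\<tau> - \<beta>) * \<beta>" "h n (card B) (card A) = (\<tau> - \<alpha>) * \<alpha>"
    by (simp_all add: h_def Let_def \<alpha>_def \<beta>_def \<tau>_def algebra_simps)
  ultimately show ?thesis by (simp add: g_def)
qed

text \<open>The decays lie between \<open>1 / sqrt n\<close> and \<open>1 / sqrt d\<close>, whose
  ratio is \<open>sqrt \<delta>\<close>; the common scale \<open>hi^2\<close> cancels from the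
  Kantorovich inequality.\<close>

lemma kantorovich_decay:
  assumes "real d = \<delta> * real n" "1 \<le> d" "d \<le> n" "0 < \<delta>" "A \<subseteq> {1..n}"
  shows "4 * sqrt \<delta> / (1 + sqrt \<delta>)\<^sup>2 * real (card A) * (\<Sum>a \<in> A. (decay d a)\<^sup>2) \<le> (\<Sum>a \<in> A. decay d a)\<^sup>2"
proof -
  define lo hi where "lo = 1 / sqrt (real n)" and "hi = 1 / sqrt (real d)"
  have fin: "finite A" using assms finite_subset by blast
  have lo: "lo = sqrt \<delta> * hi" "0 < hi"
    using assms(2-4) by (auto simp: lo_def hi_def assms(1) real_sqrt_mult)
  have "lo \<le> decay d j \<and> decay d j \<le> hi" if "j \<in> A" for j
    using that assms(2,3,5) by (auto simp: lo_def hi_def decay_def max_def intro!: divide_left_mono)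
  then have "4 * lo * hi * real (card A) * (\<Sum>a \<in> A. (decay d a)\<^sup>2) \<le> (lo + hi)\<^sup>2 * (\<Sum>a \<in> A. decay d a)\<^sup>2"
    using fin by (intro kantorovich_sum) (auto simp: lo_def)
  then have "hi\<^sup>2 * (4 * sqrt \<delta> * real (card A) * (\<Sum>a \<in> A. (decay d a)\<^sup>2)) \<le>
      hi\<^sup>2 * ((1 + sqrt \<delta>)\<^sup>2 * (\<Sum>a \<in> A. decay d a)\<^sup>2)"
    by (simp add: lo(1) power2_eq_square algebra_simps)
  then have "4 * sqrt \<delta> * real (card A) * (\<Sum>a \<in> A. (decay d a)\<^sup>2) \<le> (1 + sqrt \<delta>)\<^sup>2 * (\<Sum>a \<in> A. decay d a)\<^sup>2"
    using lo(2) by simp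
  moreover have "0 < (1 + sqrt \<delta>)\<^sup>2" using assms(4) by (intro zero_less_power add_pos_pos) auto
  ultimately show ?thesis by (simp add: field_simps)
qed

text \<open>Multiply the two hypotheses by \<open>b * t^2\<close> and \<open>a * s^2\<close> and
  add. With \<open>a\<close>, \<open>b\<close> the cardinalities, \<open>s\<close>, \<open>t\<close>
  the decay sums and \<open>p\<close>, \<open>q\<close> the sums of squares, the right side is the
  squared mean over the variance bound in the Chernoff exponent.\<close>

lemma harmonic_bound:
  fixes K s t p q :: real
  assumes "0 < K" "0 < s" "0 < t" "0 < p" "0 < q"
    and "K * a * p \<le> s\<^sup>2" "K * b * q \<le> t\<^sup>2" "0 < a" "0 < b"
  shows "K * (a * b / (a + b)) \<le> (s * t)\<^sup>2 / (p * t\<^sup>2 + q * s\<^sup>2)"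
proof -
  have 1: "K * a * p * (b * t\<^sup>2) \<le> s\<^sup>2 * (b * t\<^sup>2)" using assms by (intro mult_right_mono) auto
  have 2: "K * b * q * (a * s\<^sup>2) \<le> t\<^sup>2 * (a * s\<^sup>2)" using assms by (intro mult_right_mono) auto
  have "K * (a * b) * (p * t\<^sup>2 + q * s\<^sup>2) \<le> (s * t)\<^sup>2 * (a + b)"
    using 1 2 by (simp add: power_mult_distrib algebra_simps)
  moreover have "0 < p * t\<^sup>2 + q * s\<^sup>2" using assms by (intro add_pos_pos) auto
  ultimately show ?thesis using assms by (simp add: field_simps)
qed

section \<open>The bound for one pair of sets\<close>

text \<open>The integrand is split at a fraction \<open>1 - \<epsilon>\<close> of the mean of the
  linear form: below it the Chernoff bound gives the first term of \<open>H\<close>, above it the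
  integrand itself gives the second. The factor 2 pays for adding the two contributions.\<close>

lemma pair_bound_integral_le:
  assumes "1 \<le> m" "real d = \<delta> * real n" "1 \<le> d" "d \<le> n" "0 < \<delta>"
    and "A \<subseteq> {1..n}" "B \<subseteq> {1..n}" "A \<inter> B = {}" "d + card A + card B \<le> n" "A \<noteq> {}" "B \<noteq> {}"
    and "0 < \<epsilon>" "\<epsilon> < 1" "0 \<le> c"
  shows "(\<integral>\<^sup>+w. ennreal (exp (- c * (\<Sum>k = 1..m * n. load n d A B (block m k) * w k))) \<partial>weight_law m n)
    \<le> ennreal (2 * exp (- real m * H c n \<epsilon> \<delta> (card A) (card B)))"
proof -
  interpret prob_space "weight_law m n" by (rule prob_space_weight_law)
  define s t p q where "s = (\<Sum>a \<in> A. decay d a)" and "t = (\<Sum>b \<in> B. decay d b)"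
    and "p = (\<Sum>a \<in> A. (decay d a)\<^sup>2)" and "q = (\<Sum>b \<in> B. (decay d b)\<^sup>2)"
  have fin: "finite A" "finite B" using assms finite_subset by blast+
  have pos: "0 < s" "0 < t" "0 < p" "0 < q"
    unfolding s_def t_def p_def q_def using fin assms decay_pos[OF assms(3)]
    by (auto intro!: sum_pos zero_less_power)
  define P Q where "P = s * t" and "Q = p * t\<^sup>2 + q * s\<^sup>2"
  have PQ: "0 < P" "0 < Q" unfolding P_def Q_def using pos by (auto intro!: add_pos_pos)
  \<comment> \<open>Per unit of \<open>m\<close> the Chernoff exponent is at most
    \<open>- \<epsilon> * \<theta> * P + \<theta>^2 * Q / 2\<close>; this choice minimises
    it.\<close>
  define \<theta> where "\<theta> = \<epsilon> * P / Q"
  \<comment> \<open>The mean of \<open>?S\<close> is \<open>real m * P\<close>.\<close>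
  define M where "M = (1 - \<epsilon>) * real m * P"
  let ?S = "\<lambda>w. \<Sum>k = 1..m * n. load n d A B (block m k) * w k"
  have sl: "(\<Sum>b = 1..n. load n d A B b) = P"
    unfolding P_def s_def t_def using assms by (intro sum_load)
  have sq: "(\<Sum>b = 1..n. (load n d A B b)\<^sup>2) \<le> Q"
    unfolding Q_def p_def q_def s_def t_def using assms by (intro sum_load_square_le)
  have \<theta>: "0 \<le> \<theta>" using PQ assms by (simp add: \<theta>_def)
  have [measurable]: "?S \<in> borel_measurable (weight_law m n)"
    unfolding weight_law_def by (intro borel_measurable_sum borel_measurable_times) auto
  have "(\<integral>\<^sup>+w. ennreal (exp (- c * ?S w)) \<partial>weight_law m n)
      \<le> (\<integral>\<^sup>+w. ennreal (exp (\<theta> * M)) * ennreal (exp (- (\<theta> * ?S w))) + ennreal (exp (- c * M)) \<partial>weight_law m n)"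
  proof (rule nn_integral_mono_AE)
    show "AE w in weight_law m n. ennreal (exp (- c * ?S w))
        \<le> ennreal (exp (\<theta> * M)) * ennreal (exp (- (\<theta> * ?S w))) + ennreal (exp (- c * M))"
      using AE_weight_law_pos
    proof eventually_elim
      case (elim w)
      have S0: "0 \<le> ?S w"
        using elim load_nonneg by (intro sum_nonneg mult_nonneg_nonneg) (auto intro: less_imp_le)
      \<comment> \<open>A pointwise form of the split: the first summand is at least 1 when
        \<open>?S w <= M\<close>, and the second suffices otherwise.\<close>
      have "exp (- c * ?S w) \<le> exp (\<theta> * M + - (\<theta> * ?S w)) + exp (- c * M)"
      proof (cases "?S w \<le> M")
        case True
        then have "\<theta> * ?S w \<le> \<theta> * M" using \<theta> by (rule mult_left_mono)
        then have "1 \<le> exp (\<theta> * M + - (\<theta> * ?S w))" by simp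
        moreover have "exp (- c * ?S w) \<le> 1" using S0 assms(14) by simp
        moreover have "0 \<le> exp (- c * M)" by simp
        ultimately show ?thesis by linarith
      next
        case False
        then have "c * M \<le> c * ?S w" using assms(14) by (intro mult_left_mono) auto
        then have "exp (- c * ?S w) \<le> exp (- c * M)" by simp
        moreover have "0 \<le> exp (\<theta> * M + - (\<theta> * ?S w))" by simp
        ultimately show ?thesis by linarith
      qed
      then show ?case
        unfolding exp_add by (simp add: ennreal_mult'[symmetric] ennreal_plus[symmetric] ennreal_leI del: ennreal_plus)
    qed
  qed
  also have "\<dots> = ennreal (exp (\<theta> * M)) * (\<integral>\<^sup>+w. ennreal (exp (- (\<theta> * ?S w))) \<partial>weight_law m n) + ennreal (exp (- c * M))"
    by (simp add: nn_integral_add nn_integral_cmult emeasure_space_1)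
  also have "(\<integral>\<^sup>+w. ennreal (exp (- (\<theta> * ?S w))) \<partial>weight_law m n)
      \<le> ennreal (exp (\<Sum>k = 1..m * n. - (\<theta> * load n d A B (block m k)) + (\<theta> * load n d A B (block m k))\<^sup>2 / 2))"
    using weight_law_laplace_le[of "\<lambda>k. \<theta> * load n d A B (block m k)" m n] \<theta> load_nonneg
    by (simp add: sum_distrib_left mult.assoc)
  also have "(\<Sum>k = 1..m * n. - (\<theta> * load n d A B (block m k)) + (\<theta> * load n d A B (block m k))\<^sup>2 / 2)
      = real m * (\<Sum>b = 1..n. - (\<theta> * load n d A B b) + (\<theta> * load n d A B b)\<^sup>2 / 2)"
    by (rule sum_block[OF assms(1)])
  also have "(\<Sum>b = 1..n. - (\<theta> * load n d A B b) + (\<theta> * load n d A B b)\<^sup>2 / 2)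
      = - \<theta> * P + \<theta>\<^sup>2 / 2 * (\<Sum>b = 1..n. (load n d A B b)\<^sup>2)"
    unfolding sl[symmetric] by (simp add: sum.distrib sum_subtractf sum_negf sum_distrib_left power_mult_distrib sum_divide_distrib)
  finally have "(\<integral>\<^sup>+w. ennreal (exp (- c * ?S w)) \<partial>weight_law m n)
      \<le> ennreal (exp (\<theta> * M)) * ennreal (exp (real m * (- \<theta> * P + \<theta>\<^sup>2 / 2 * (\<Sum>b = 1..n. (load n d A B b)\<^sup>2))))
        + ennreal (exp (- c * M))"
    by (simp add: add_right_mono mult_left_mono)
  also have "\<dots> = ennreal (exp (\<theta> * M + real m * (- \<theta> * P + \<theta>\<^sup>2 / 2 * (\<Sum>b = 1..n. (load n d A B b)\<^sup>2)))
        + exp (- c * M))"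
    by (simp add: exp_add ennreal_mult')
  also have "\<dots> \<le> ennreal (2 * exp (- real m * H c n \<epsilon> \<delta> (card A) (card B)))"
  proof (rule ennreal_leI)
    let ?K = "4 * sqrt \<delta> / (1 + sqrt \<delta>)\<^sup>2"
    let ?H1 = "2 * \<epsilon>\<^sup>2 * sqrt \<delta> / (1 + sqrt \<delta>)\<^sup>2 * (real (card A) * real (card B) / (real (card A) + real (card B)))"
    let ?H2 = "c * (1 - \<epsilon>) * g n (card A) (card B)"
    have K0: "0 < ?K" using assms(5) by (intro divide_pos_pos zero_less_power add_pos_pos) auto
    have "?K * (real (card A) * real (card B) / (real (card A) + real (card B))) \<le> P\<^sup>2 / Q"
      unfolding P_def Q_def
    proof (rule harmonic_bound[OF K0 pos])
      show "?K * real (card A) * p \<le> s\<^sup>2" "?K * real (card B) * q \<le> t\<^sup>2"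
        unfolding p_def s_def q_def t_def using kantorovich_decay assms by blast+
    qed (use fin assms(10,11) in \<open>auto simp: card_gt_0_iff\<close>)
    then have "\<epsilon>\<^sup>2 / 2 * (?K * (real (card A) * real (card B) / (real (card A) + real (card B)))) \<le> \<epsilon>\<^sup>2 / 2 * (P\<^sup>2 / Q)"
      by (intro mult_left_mono) auto
    then have H1: "?H1 \<le> \<epsilon>\<^sup>2 / 2 * (P\<^sup>2 / Q)" by (simp add: mult_ac)
    have "\<theta> * M + real m * (- \<theta> * P + \<theta>\<^sup>2 / 2 * (\<Sum>b = 1..n. (load n d A B b)\<^sup>2))
        \<le> \<theta> * M + real m * (- \<theta> * P + \<theta>\<^sup>2 / 2 * Q)"
      using sq by (intro add_left_mono mult_left_mono) auto
    also have "\<dots> = real m * (- (\<epsilon> * \<theta> * P) + \<theta>\<^sup>2 / 2 * Q)"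
      by (simp add: M_def algebra_simps)
    \<comment> \<open>The value of the quadratic at its minimum.\<close>
    also have "- (\<epsilon> * \<theta> * P) + \<theta>\<^sup>2 / 2 * Q = - (\<epsilon>\<^sup>2 / 2 * (P\<^sup>2 / Q))"
      using PQ by (simp add: \<theta>_def power2_eq_square field_simps)
    also have "real m * - (\<epsilon>\<^sup>2 / 2 * (P\<^sup>2 / Q)) \<le> real m * - ?H1"
      using H1 by (intro mult_left_mono) auto
    also have "\<dots> \<le> real m * - H c n \<epsilon> \<delta> (card A) (card B)"
      by (intro mult_left_mono) (auto simp: H_def)
    finally have 1: "\<theta> * M + real m * (- \<theta> * P + \<theta>\<^sup>2 / 2 * (\<Sum>b = 1..n. (load n d A B b)\<^sup>2))
        \<le> - real m * H c n \<epsilon> \<delta> (card A) (card B)" by simp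
    have "g n (card A) (card B) \<le> P"
      unfolding P_def s_def t_def using assms by (intro g_le_decay_sums)
    then have "?H2 \<le> c * (1 - \<epsilon>) * P"
      using assms by (intro mult_left_mono) auto
    then have "H c n \<epsilon> \<delta> (card A) (card B) \<le> c * (1 - \<epsilon>) * P" by (simp add: H_def)
    then have "real m * H c n \<epsilon> \<delta> (card A) (card B) \<le> real m * (c * (1 - \<epsilon>) * P)"
      by (intro mult_left_mono) auto
    then have 2: "- c * M \<le> - real m * H c n \<epsilon> \<delta> (card A) (card B)"
      by (simp add: M_def mult_ac)
    show "exp (\<theta> * M + real m * (- \<theta> * P + \<theta>\<^sup>2 / 2 * (\<Sum>b = 1..n. (load n d A B b)\<^sup>2))) + exp (- c * M)
        \<le> 2 * exp (- real m * H c n \<epsilon> \<delta> (card A) (card B))"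
      using 1 2 by (smt (verit) exp_le_cancel_iff)
  qed
  finally show ?thesis .
qed

subsection \<open>The union bound\<close>

definition disjoint_pairs :: "nat \<Rightarrow> nat \<Rightarrow> nat \<Rightarrow> (nat set \<times> nat set) set" where
  "disjoint_pairs n \<mu> \<nu> =
     {(A, B). A \<subseteq> {1..n} \<and> B \<subseteq> {1..n} \<and> A \<inter> B = {} \<and> card A = \<mu> \<and> card B = \<nu>}"

lemma finite_disjoint_pairs: "finite (disjoint_pairs n \<mu> \<nu>)"
  by (rule finite_subset[of _ "Pow {1..n} \<times> Pow {1..n}"]) (auto simp: disjoint_pairs_def)

text \<open>A pair is determined by its union together with \<open>A\<close>, as \<open>B\<close> is
  the difference: first choose the union, then \<open>A\<close> inside it.\<close>

lemma card_disjoint_pairs_le: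
  "card (disjoint_pairs n \<mu> \<nu>) \<le> (n choose (\<mu> + \<nu>)) * ((\<mu> + \<nu>) choose \<mu>)"
proof -
  let ?U = "{U. U \<subseteq> {1..n} \<and> card U = \<mu> + \<nu>}"
  let ?T = "Sigma ?U (\<lambda>U. {A. A \<subseteq> U \<and> card A = \<mu>})"
  have finU: "finite ?U" by simp
  have fin: "finite U" if "U \<in> ?U" for U
    using that finite_subset[of U "{1..n}"] by simp
  have finA: "finite {A. A \<subseteq> U \<and> card A = \<mu>}" if "U \<in> ?U" for U
    by (rule finite_subset[of _ "Pow U"]) (use fin[OF that] in auto)
  have inner: "card {A. A \<subseteq> U \<and> card A = \<mu>} = (\<mu> + \<nu>) choose \<mu>" if "U \<in> ?U" for U
    using n_subsets[OF fin[OF that], of \<mu>] that unfolding mem_Collect_eq by presburger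
  have "card ?T = (\<Sum>U \<in> ?U. card {A. A \<subseteq> U \<and> card A = \<mu>})"
    by (rule card_SigmaI[OF finU]) (rule ballI, rule finA)
  also have "\<dots> = card ?U * ((\<mu> + \<nu>) choose \<mu>)"
    using inner by simp
  also have "card ?U = n choose (\<mu> + \<nu>)"
    using n_subsets[of "{1..n}" "\<mu> + \<nu>"] by simp
  finally have "card ?T = (n choose (\<mu> + \<nu>)) * ((\<mu> + \<nu>) choose \<mu>)" .
  moreover have "card (disjoint_pairs n \<mu> \<nu>) \<le> card ?T"
  proof (rule card_inj_on_le[where f = "\<lambda>(A, B). (A \<union> B, A)"])
    show "inj_on (\<lambda>(A, B). (A \<union> B, A)) (disjoint_pairs n \<mu> \<nu>)"
      by (rule inj_on_inverseI[where g = "\<lambda>(U, A). (A, U - A)"]) (auto simp: disjoint_pairs_def)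
    show "(\<lambda>(A, B). (A \<union> B, A)) ` disjoint_pairs n \<mu> \<nu> \<subseteq> ?T"
    proof (rule image_subsetI)
      fix z assume "z \<in> disjoint_pairs n \<mu> \<nu>"
      then obtain A B where z: "z = (A, B)" "A \<subseteq> {1..n}" "B \<subseteq> {1..n}" "A \<inter> B = {}" "card A = \<mu>" "card B = \<nu>"
        by (auto simp: disjoint_pairs_def)
      moreover have "finite A" "finite B"
        using z(2,3) finite_subset[of _ "{1..n}"] by auto
      ultimately show "(case z of (A, B) \<Rightarrow> (A \<union> B, A)) \<in> ?T" by (auto simp: card_Un_disjoint)
    qed
    show "finite ?T"
      by (rule finite_SigmaI[OF finU finA])
  qed
  ultimately show ?thesis by simp
qed

text \<open>Disintegration along the two binds, so that the attachment points can be treated with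
  the weights held fixed.\<close>

lemma emeasure_pa_space:
  assumes "X \<in> sets (pa_space m n)"
  shows "emeasure (pa_space m n) X = (\<integral>\<^sup>+w. \<integral>\<^sup>+l. indicator X (w, l) \<partial>attach_law m n w \<partial>weight_law m n)"
proof -
  interpret prob_space "weight_law m n" by (rule prob_space_weight_law)
  let ?K = "PiM {1..m * n + 1} (\<lambda>_. borel :: real measure) \<Otimes>\<^sub>M PiM {1..m * n} (\<lambda>_. borel :: real measure)"
  have X: "X \<in> sets ?K" using assms by (simp add: sets_pa_space)
  have "emeasure (pa_space m n) X =
      (\<integral>\<^sup>+w. emeasure (attach_law m n w \<bind> (\<lambda>l. return ?K (w, l))) X \<partial>weight_law m n)"
    unfolding pa_space_def
  proof (rule emeasure_bind[OF not_empty _ X])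
    show "(\<lambda>w. attach_law m n w \<bind> (\<lambda>l. return ?K (w, l))) \<in> weight_law m n \<rightarrow>\<^sub>M subprob_algebra ?K"
      by (rule measurable_bind[where N = "PiM {1..m * n} (\<lambda>_. borel)"]) measurable
  qed
  also have "\<dots> = (\<integral>\<^sup>+w. \<integral>\<^sup>+l. indicator X (w, l) \<partial>attach_law m n w \<partial>weight_law m n)"
  proof (rule nn_integral_cong)
    fix w assume "w \<in> space (weight_law m n)"
    then have w [measurable]: "w \<in> space (PiM {1..m * n + 1} (\<lambda>_. borel))"
      using sets_eq_imp_space_eq[OF sets_weight_law] by blast
    have "emeasure (attach_law m n w \<bind> (\<lambda>l. return ?K (w, l))) X =
        (\<integral>\<^sup>+l. emeasure (return ?K (w, l)) X \<partial>attach_law m n w)"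
    proof (rule emeasure_bind[OF _ _ X])
      show "space (attach_law m n w) \<noteq> {}" by (simp add: space_attach_law PiE_eq_empty_iff)
      show "(\<lambda>l. return ?K (w, l)) \<in> attach_law m n w \<rightarrow>\<^sub>M subprob_algebra ?K" by measurable
    qed
    also have "\<dots> = (\<integral>\<^sup>+l. indicator X (w, l) \<partial>attach_law m n w)"
      by (intro nn_integral_cong emeasure_return[OF X])
    finally show "emeasure (attach_law m n w \<bind> (\<lambda>l. return ?K (w, l))) X =
        (\<integral>\<^sup>+l. indicator X (w, l) \<partial>attach_law m n w)" .
  qed
  finally show ?thesis .
qed

lemma indicator_mono_imp: "(x \<in> S \<Longrightarrow> y \<in> T) \<Longrightarrow> indicator S x \<le> (indicator T y :: ennreal)"
  by (auto simp: indicator_def)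

lemma separation_prob_le:
  assumes "1 \<le> m" "1 \<le> \<mu>" "1 \<le> \<nu>" "0 < \<delta>" "real (\<mu> + \<nu>) = (1 - \<delta>) * real n" "0 < \<epsilon>" "\<epsilon> < 1"
  defines "c \<equiv> 1 / (2 * (1 + real n powr (-1/2) * ln (real n)))"
  shows "separation_prob m n \<delta> \<mu> \<nu>
    \<le> 2 * real (n choose (\<mu> + \<nu>)) * real ((\<mu> + \<nu>) choose \<mu>) * exp (- real m * H c n \<epsilon> \<delta> \<mu> \<nu>)"
proof -
  \<comment> \<open>The natural number equal to \<open>\<delta> * n\<close>; the subtraction does
    not truncate because \<open>\<mu> + \<nu> < n\<close>.\<close>
  define d where "d = n - (\<mu> + \<nu>)"
  have n: "n \<noteq> 0" using assms(2,5) by (intro notI) simp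
  have dn: "\<delta> * real n = real n - real (\<mu> + \<nu>)" using assms(5) by (simp add: algebra_simps)
  moreover have "0 < \<delta> * real n" using n assms(4) by simp
  ultimately have lt: "\<mu> + \<nu> < n" by linarith
  have d: "real d = \<delta> * real n" "1 \<le> d" "d \<le> n" "d + \<mu> + \<nu> = n"
    using lt dn by (auto simp: d_def of_nat_diff)
  have c0: "0 \<le> c" using n by (auto simp: c_def intro!: add_nonneg_nonneg mult_nonneg_nonneg)
  let ?S = "disjoint_pairs n \<mu> \<nu>" and ?b = "exp (- real m * H c n \<epsilon> \<delta> \<mu> \<nu>)"
  let ?F = "\<lambda>w (A, B). ennreal (exp (- c * (\<Sum>k = 1..m * n. load n d A B (block m k) * w k)))"
  let ?box = "\<lambda>w (A, B). Pi\<^sub>E {1..m * n}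
      (\<lambda>k. - (\<Union>b \<in> earlier_opposite A B (block m k). vertex_interval m n w b))"
  let ?X = "{(w, l) \<in> space (pa_space m n).
          W_event m n \<delta> w \<and>
          (\<exists>A B. A \<subseteq> {1..n} \<and> B \<subseteq> {1..n} \<and> A \<inter> B = {} \<and> card A = \<mu> \<and> card B = \<nu> \<and>
                 no_edge_between m n w l A B)}"
  have box_sets: "?box w z \<in> sets (attach_law m n w)" if "z \<in> ?S" for w z
  proof -
    obtain A B where z: "z = (A, B)" by (cases z)
    have "finite (earlier_opposite A B a)" for a
      by (rule finite_subset[of _ "{..<a}"]) (auto simp: earlier_opposite_def)
    then show ?thesis
      unfolding z prod.case sets_attach_law
      by (intro sets_PiM_I_finite borel_comp sets.finite_UN) (auto simp: vertex_interval_def)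
  qed
  have F_meas: "(\<lambda>w. ?F w z) \<in> borel_measurable (weight_law m n)" for z
  proof -
    obtain A B where z: "z = (A, B)" by (cases z)
    have [measurable]: "(\<lambda>w. \<Sum>k = 1..m * n. load n d A B (block m k) * w k) \<in> borel_measurable (weight_law m n)"
      unfolding weight_law_def by (intro borel_measurable_sum borel_measurable_times) auto
    show ?thesis unfolding z prod.case by measurable
  qed
  \<comment> \<open>The union bound is applied conditionally on positive weights.\<close>
  have inner: "(\<integral>\<^sup>+l. indicator ?X (w, l) \<partial>attach_law m n w) \<le> (\<Sum>z \<in> ?S. ?F w z)"
    if w: "\<forall>i \<in> {1..m * n + 1}. 0 < w i" for w
  proof (cases "W_event m n \<delta> w")
    case True
    have "(\<integral>\<^sup>+l. indicator ?X (w, l) \<partial>attach_law m n w)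
        \<le> (\<integral>\<^sup>+l. indicator (\<Union>z \<in> ?S. ?box w z) l \<partial>attach_law m n w)"
    proof (rule nn_integral_mono)
      fix l assume "l \<in> space (attach_law m n w)"
      then have l: "l \<in> Pi\<^sub>E {1..m * n} (\<lambda>_. UNIV)" by (simp add: space_attach_law)
      have "l \<in> (\<Union>z \<in> ?S. ?box w z)" if "(w, l) \<in> ?X"
      proof -
        have "\<exists>A B. A \<subseteq> {1..n} \<and> B \<subseteq> {1..n} \<and> A \<inter> B = {} \<and> card A = \<mu> \<and> card B = \<nu> \<and>
            no_edge_between m n w l A B"
          using that by (simp only: mem_Collect_eq prod.case simp_thms)
        then obtain A B where AB: "A \<subseteq> {1..n}" "B \<subseteq> {1..n}" "A \<inter> B = {}" "card A = \<mu>" "card B = \<nu>"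
            "no_edge_between m n w l A B"
          by (elim exE conjE)
        then have "(A, B) \<in> ?S" by (simp add: disjoint_pairs_def)
        moreover have "l \<in> ?box w (A, B)"
          using l no_edge_between_avoids[OF assms(1) w AB(1,2,6)] unfolding prod.case PiE_iff by blast
        ultimately show ?thesis by (rule UN_I)
      qed
      then show "indicator ?X (w, l) \<le> (indicator (\<Union>z \<in> ?S. ?box w z) l :: ennreal)"
        by (rule indicator_mono_imp)
    qed
    also have "\<dots> = emeasure (attach_law m n w) (\<Union>z \<in> ?S. ?box w z)"
      using box_sets finite_disjoint_pairs by (intro nn_integral_indicator sets.finite_UN)
    also have "\<dots> \<le> (\<Sum>z \<in> ?S. emeasure (attach_law m n w) (?box w z))"
      using box_sets finite_disjoint_pairs by (intro emeasure_subadditive_finite) auto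
    also have "\<dots> \<le> (\<Sum>z \<in> ?S. ?F w z)"
    proof (intro sum_mono)
      fix z assume "z \<in> ?S"
      then obtain A B where z: "z = (A, B)" "A \<subseteq> {1..n}" "B \<subseteq> {1..n}"
        by (auto simp: disjoint_pairs_def)
      show "emeasure (attach_law m n w) (?box w z) \<le> ?F w z"
        using attach_law_avoid_le[OF assms(1) w True d(1-3) z(2,3)] unfolding z(1) prod.case
        by (simp add: c_def)
    qed
    finally show ?thesis .
  next
    \<comment> \<open>Off the event the left side vanishes, so the bound holds for all positive
      weights and the event no longer restricts the integral over them.\<close>
    case False
    then have "(\<integral>\<^sup>+l. indicator ?X (w, l) \<partial>attach_law m n w) = 0"
      by (simp add: indicator_def)
    then show ?thesis by simp
  qed
  have "emeasure (pa_space m n) ?X = (\<integral>\<^sup>+w. \<integral>\<^sup>+l. indicator ?X (w, l) \<partial>attach_law m n w \<partial>weight_law m n)"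
    by (rule emeasure_pa_space[OF separation_event_measurable])
  also have "\<dots> \<le> (\<integral>\<^sup>+w. (\<Sum>z \<in> ?S. ?F w z) \<partial>weight_law m n)"
    by (rule nn_integral_mono_AE[OF eventually_mono[OF AE_weight_law_pos inner]])
  also have "\<dots> = (\<Sum>z \<in> ?S. \<integral>\<^sup>+w. ?F w z \<partial>weight_law m n)"
    by (rule nn_integral_sum[OF F_meas])
  also have "\<dots> \<le> (\<Sum>z \<in> ?S. ennreal (2 * ?b))"
  proof (intro sum_mono)
    fix z assume "z \<in> ?S"
    then obtain A B where z: "z = (A, B)" "A \<subseteq> {1..n}" "B \<subseteq> {1..n}" "A \<inter> B = {}" "card A = \<mu>" "card B = \<nu>"
      by (auto simp: disjoint_pairs_def)
    have ne: "A \<noteq> {}" "B \<noteq> {}" using z assms(2,3) by auto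
    show "(\<integral>\<^sup>+w. ?F w z \<partial>weight_law m n) \<le> ennreal (2 * ?b)"
      using pair_bound_integral_le[OF assms(1) d(1-3) assms(4) z(2-4) _ ne assms(6,7) c0] d(4)
      unfolding z(1,5,6) prod.case by simp
  qed
  also have "\<dots> = ennreal (real (card ?S) * (2 * ?b))"
    by (simp add: ennreal_of_nat_eq_real_of_nat flip: ennreal_mult')
  finally have "emeasure (pa_space m n) ?X \<le> ennreal (real (card ?S) * (2 * ?b))" .
  then have "separation_prob m n \<delta> \<mu> \<nu> \<le> real (card ?S) * (2 * ?b)"
    unfolding separation_prob_def measure_def by (intro enn2real_leI) auto
  also have "\<dots> \<le> real ((n choose (\<mu> + \<nu>)) * ((\<mu> + \<nu>) choose \<mu>)) * (2 * ?b)"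
    using card_disjoint_pairs_le by (intro mult_right_mono of_nat_mono) auto
  finally show ?thesis by (simp add: mult_ac)
qed

theorem theorem3p3:
  fixes m :: nat and \<delta>\<^sub>0 \<delta>\<^sub>1 :: real
  assumes "m \<ge> 1" and "0 < \<delta>\<^sub>0" and "\<delta>\<^sub>1 < 1"
  shows "\<exists>c :: nat \<Rightarrow> real. c \<longlonglongrightarrow> 1/2 \<and>
    (\<forall>(n::nat) (\<mu>::nat) (\<nu>::nat) (\<delta>::real) (\<epsilon>::real).
       \<mu> \<ge> 1 \<and> \<nu> \<ge> 1 \<and> \<delta>\<^sub>0 \<le> \<delta> \<and> \<delta> \<le> \<delta>\<^sub>1 \<and> real (\<mu> + \<nu>) = (1 - \<delta>) * real n \<and>
       0 < \<epsilon> \<and> \<epsilon> < 1 \<longrightarrow>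
         separation_prob m n \<delta> \<mu> \<nu>
           \<le> 2 * real (n choose (\<mu> + \<nu>)) * real ((\<mu> + \<nu>) choose \<mu>)
               * exp (- real m * H (c n) n \<epsilon> \<delta> \<mu> \<nu>) \<and>
         (\<mu> \<ge> \<nu> \<longrightarrow> g n \<mu> \<nu> = h n \<mu> \<nu>) \<and>
         (\<mu> \<le> \<nu> \<longrightarrow> g n \<mu> \<nu> = h n \<nu> \<mu>))"
proof (intro exI conjI allI impI)
  \<comment> \<open>The factor \<open>1/2\<close> comes from the attachment density and the
    correction from the bound in \<open>W_event\<close>. The witness depends on \<open>n\<close>
    alone, hence is uniform in \<open>\<delta>\<close>, \<open>\<epsilon>\<close>,
    \<open>\<mu>\<close> and \<open>\<nu>\<close>.\<close>
  let ?c = "\<lambda>n::nat. 1 / (2 * (1 + real n powr (-1/2) * ln (real n)))"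
  have "(\<lambda>n. ln (real n) / real n powr (1/2)) \<longlonglongrightarrow> 0"
    using lim_ln_over_power[of "1/2"] by simp
  then have "(\<lambda>n. real n powr (-1/2) * ln (real n)) \<longlonglongrightarrow> 0"
    by (simp add: powr_minus_divide)
  then have "?c \<longlonglongrightarrow> 1 / (2 * (1 + 0))"
    by (intro tendsto_intros) auto
  then show "?c \<longlonglongrightarrow> 1/2" by simp
  fix n \<mu> \<nu> :: nat and \<delta> \<epsilon> :: real
  assume a: "\<mu> \<ge> 1 \<and> \<nu> \<ge> 1 \<and> \<delta>\<^sub>0 \<le> \<delta> \<and> \<delta> \<le> \<delta>\<^sub>1 \<and> real (\<mu> + \<nu>) = (1 - \<delta>) * real n \<and> 0 < \<epsilon> \<and> \<epsilon> < 1"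
  then show "separation_prob m n \<delta> \<mu> \<nu> \<le> 2 * real (n choose (\<mu> + \<nu>)) * real ((\<mu> + \<nu>) choose \<mu>)
               * exp (- real m * H (?c n) n \<epsilon> \<delta> \<mu> \<nu>)"
    using assms by (intro separation_prob_le) auto
  have "(1 - \<delta>) * real n \<le> 1 * real n" using a assms by (intro mult_right_mono) auto
  then have le: "\<mu> + \<nu> \<le> n" using a by linarith
  show "g n \<mu> \<nu> = h n \<mu> \<nu>" if "\<mu> \<ge> \<nu>"
    using h_le_h_swap[OF that le] by (simp add: g_def)
  show "g n \<mu> \<nu> = h n \<nu> \<mu>" if "\<mu> \<le> \<nu>"
    using h_le_h_swap[OF that] le by (simp add: g_def)
qed

end
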